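(* There exist absolute (numerical) constants $A_0>0$, $c_0>0$ and $C>0$ such that the following holds. Let $p\ge 2$, let $X\in\mathbb{R}^{n\times p}$ have unit-normed columns and obey the coherence property $\mu(X)\le A_0(\log p)^{-1}$, and let $\sigma>0$. Let $S\ge 1$ be an integer with $S\le c_0\,p/[\|X\|^2\log p]$. Let $\beta\in\mathbb{R}^p$ be drawn from the generic $S$-sparse model, let $I$ be the support of $\beta$, and suppose that $$\min_{i\in I}|\beta_i|>8\sigma\sqrt{2\log p}.$$ Let $z\sim\mathcal{N}(0,\sigma^2I_n)$ be independent of $\beta$ and let $y=X\beta+z$. Then the lasso estimate $$\hat\beta\in\arg\min_{b\in\mathbb{R}^p}\ \tfrac12\|y-Xb\|_{\ell_2}^2+\lambda\sigma\|b\|_{\ell_1}\qquad\text{with }\lambda=2\sqrt{2\log p}$$ obeys $$\mathrm{supp}(\hat\beta)=\mathrm{supp}(\beta)\quad\text{and}\quad \mathrm{sgn}(\hat\beta_i)=\mathrm{sgn}(\beta_i)\ \text{ for all } i\in I$$ with probability at least $1-2p^{-1}\big((2\pi\log p)^{-1/2}+|I|p^{-1}\big)-C\,p^{-2\log 2}$.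
   Context: $\|X\|$ is the operator norm (largest singular value) of $X$. Writing $X_i$ for the $i$th column of $X$ (with $\|X_i\|_{\ell_2}=1$), the coherence is $\mu(X)=\sup_{1\le i<j\le p}|\langle X_i,X_j\rangle|$. $\mathrm{supp}(b)=\{i:b_i\neq0\}$. Generic $S$-sparse model: $\beta\in\mathbb{R}^p$ is a random vector such that (1) its support $I=\{i:\beta_i\ne0\}$ is selected uniformly at random among the subsets of $\{1,\dots,p\}$ of cardinality $S$ (so $|I|=S$); (2) conditional on $I$, the signs of the nonzero entries of $\beta$ are independent and equally likely to be $-1$ or $1$. No assumption is made on the amplitudes $|\beta_i|$, $i\in I$, beyond the lower bound required in the claim (which holds almost surely). The probability is over both $\beta$ and $z$. *)

theory Defs
  imports "HOL-Probability.Probability"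
begin

text \<open>
  The constants of the theorem must not depend on the dimensions, so n and p are
  natural-number variables rather than type parameters.  A vector of dimension p is a function
  on \<open>{..<p}\<close>, extended by \<open>undefined\<close> as in \<open>\<Pi>\<^sub>M\<close>; an n x p matrix is a function
  \<open>X i j\<close> (row \<open>i < n\<close>, column \<open>j < p\<close>) whose other values are never used.
\<close>

definition Rvec :: "nat \<Rightarrow> (nat \<Rightarrow> real) set" where
  "Rvec p = ({..<p} \<rightarrow>\<^sub>E UNIV)"

definition inner_n :: "nat \<Rightarrow> (nat \<Rightarrow> real) \<Rightarrow> (nat \<Rightarrow> real) \<Rightarrow> real" where
  "inner_n n u v = (\<Sum>i<n. u i * v i)"

definition norm1 :: "nat \<Rightarrow> (nat \<Rightarrow> real) \<Rightarrow> real" where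
  "norm1 p b = (\<Sum>j<p. \<bar>b j\<bar>)"

abbreviation norm2 :: "nat \<Rightarrow> (nat \<Rightarrow> real) \<Rightarrow> real" where
  "norm2 n v \<equiv> L2_set v {..<n}"

definition supp :: "nat \<Rightarrow> (nat \<Rightarrow> real) \<Rightarrow> nat set" where
  "supp p b = {i. i < p \<and> b i \<noteq> 0}"

definition mat_vec :: "nat \<Rightarrow> (nat \<Rightarrow> nat \<Rightarrow> real) \<Rightarrow> (nat \<Rightarrow> real) \<Rightarrow> nat \<Rightarrow> real" where
  "mat_vec p X b = (\<lambda>i. \<Sum>j<p. X i j * b j)"

definition mat_col :: "(nat \<Rightarrow> nat \<Rightarrow> real) \<Rightarrow> nat \<Rightarrow> nat \<Rightarrow> real" where
  "mat_col X j = (\<lambda>i. X i j)"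

text \<open>Same form as \<open>onorm\<close>, including \<open>0 / 0 = 0\<close> at the zero vector.\<close>

definition op_norm :: "nat \<Rightarrow> nat \<Rightarrow> (nat \<Rightarrow> nat \<Rightarrow> real) \<Rightarrow> real" where
  "op_norm n p X = (SUP v\<in>Rvec p. norm2 n (mat_vec p X v) / norm2 p v)"

definition coherence :: "nat \<Rightarrow> nat \<Rightarrow> (nat \<Rightarrow> nat \<Rightarrow> real) \<Rightarrow> real" where
  "coherence n p X =
     (SUP (i, j)\<in>{(i, j). i < j \<and> j < p}. \<bar>inner_n n (mat_col X i) (mat_col X j)\<bar>)"

text \<open>
  \<open>D\<close> is the law of a random vector of dimension p drawn from the generic S-sparse model.
  Conditioning on the event that the support equals \<open>J\<close> is conditioning on an event of positive
  probability, that is, passing to \<open>uniform_measure\<close>.  The amplitudes are unconstrained and may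
  depend on the support and on the signs.
\<close>

definition generic_sparse :: "nat \<Rightarrow> nat \<Rightarrow> (nat \<Rightarrow> real) measure \<Rightarrow> bool" where
  "generic_sparse p S D \<longleftrightarrow>
     prob_space D \<and> sets D = sets (\<Pi>\<^sub>M i\<in>{..<p}. (borel :: real measure)) \<and>
     S \<le> p \<and>
     distr D (count_space UNIV) (supp p) = measure_pmf (pmf_of_set {J. J \<subseteq> {..<p} \<and> card J = S}) \<and>
     (\<forall>J. J \<subseteq> {..<p} \<and> card J = S \<longrightarrow>
        (let Q = uniform_measure D {\<beta> \<in> space D. supp p \<beta> = J} in
           prob_space.indep_vars Q (\<lambda>_. borel) (\<lambda>i \<beta>. sgn (\<beta> i)) J \<and>
           (\<forall>i\<in>J. \<P>(\<beta> in Q. sgn (\<beta> i) = 1) = 1 / 2 \<and>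
                  \<P>(\<beta> in Q. sgn (\<beta> i) = - 1) = 1 / 2)))"

text \<open>The law of a centred Gaussian vector with covariance \<open>\<sigma>\<^sup>2\<close> times the n x n identity.\<close>

definition gaussian_noise :: "nat \<Rightarrow> real \<Rightarrow> (nat \<Rightarrow> real) measure" where
  "gaussian_noise n \<sigma> = (\<Pi>\<^sub>M i\<in>{..<n}. density lborel (\<lambda>x. ennreal (normal_density 0 \<sigma> x)))"

definition lasso_objective ::
  "nat \<Rightarrow> nat \<Rightarrow> (nat \<Rightarrow> nat \<Rightarrow> real) \<Rightarrow> (nat \<Rightarrow> real) \<Rightarrow> real \<Rightarrow> real \<Rightarrow> (nat \<Rightarrow> real) \<Rightarrow> real" where
  "lasso_objective n p X y lam \<sigma> b =
     1 / 2 * (norm2 n (\<lambda>i. y i - mat_vec p X b i))\<^sup>2 + lam * \<sigma> * norm1 p b"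

text \<open>The minimiser need not be unique; this says that \<open>b\<close> is one of them.\<close>

definition lasso_estimate ::
  "nat \<Rightarrow> nat \<Rightarrow> (nat \<Rightarrow> nat \<Rightarrow> real) \<Rightarrow> (nat \<Rightarrow> real) \<Rightarrow> real \<Rightarrow> real \<Rightarrow> (nat \<Rightarrow> real) \<Rightarrow> bool" where
  "lasso_estimate n p X y lam \<sigma> b \<longleftrightarrow>
     is_arg_min (lasso_objective n p X y lam \<sigma>) (\<lambda>b. b \<in> Rvec p) b"

text \<open>
  An event holds with probability at least \<open>q\<close> if it contains a measurable event of
  probability at least \<open>q\<close>; for measurable events this is the usual meaning, and it needs no
  measurability of the choice of minimiser.
\<close>

definition with_prob_ge :: "'a measure \<Rightarrow> real \<Rightarrow> ('a \<Rightarrow> bool) \<Rightarrow> bool" where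
  "with_prob_ge M q P \<longleftrightarrow> (\<exists>E\<in>sets M. measure M E \<ge> q \<and> (\<forall>\<omega>\<in>E. P \<omega>))"

end

theory Submission
  imports Defs
begin

text \<open>
  Write \<open>I\<close> for the support of \<open>\<beta>\<close> and \<open>G\<close> for the Gram matrix of the columns of \<open>X\<close>.  The proof
  has a deterministic, a conditional and a combinatorial layer.

  Deterministic layer.  Guess that the minimiser lives on \<open>I\<close> and has the signs of \<open>\<beta>\<close>.  Stationarity
  on \<open>I\<close> then determines it, and convexity makes the guess the only minimiser as soon as the Gram
  matrix of \<open>I\<close> is positive definite, the guessed signs are the actual ones, and the residual has
  correlation strictly below \<open>\<lambda>\<sigma>\<close> with every column outside \<open>I\<close> (\<open>lasso_estimate_unique\<close>).  Project
  each column \<open>X\<^sub>j\<close> onto the span of the columns in \<open>I - {j}\<close>; let \<open>w\<^sub>j\<close> be the coefficients and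
  \<open>u\<^sub>j\<close> the residual of this projection.  All conditions follow from smallness of the two families
  \<open>\<langle>w\<^sub>j, sgn \<beta>\<rangle>\<close> and \<open>\<langle>u\<^sub>j, z\<rangle>\<close>, with \<open>j\<close> ranging over all columns: indices outside \<open>I\<close> give the
  correlations, indices in \<open>I\<close> give the entries of the minimiser (\<open>lasso_sign_recovery\<close>).

  Conditional layer.  Given \<open>I\<close>, both families are subgaussian.  Since \<open>\<bar>u\<^sub>j\<bar> \<le> 1\<close>, a union bound over
  \<open>p\<close> Gaussian tails suffices; and if \<open>\<bar>w\<^sub>j\<bar>\<^sup>2\<close> is a small multiple of \<open>1 / log p\<close>, Hoeffding's
  inequality for random signs does the rest.

  Combinatorial layer.  It remains to see that most \<open>S\<close>-subsets \<open>I\<close> have a positive definite Gram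
  matrix and small \<open>w\<^sub>j\<close> (\<open>most_supports_well_conditioned\<close>).  In place of a matrix
  concentration inequality this is done with scalars, by a moving barrier in the style of Batson,
  Spielman and Srivastava.  For a shift \<open>s\<close> consider the energies
  \<open>E\<^sub>j = v\<^sub>j\<^sup>T (G\<^sub>I - s Id)\<^sup>-\<^sup>1 v\<^sub>j\<close> of the vectors \<open>v\<^sub>j = (G i j)\<close>, \<open>i \<in> I\<close>, and let \<open>I\<close> grow by one
  uniformly random element \<open>i\<close> at a time.  By a Schur complement, the shifted matrix stays positive
  definite while the energies are small, and \<open>E\<^sub>j\<close> grows by a quantity of order \<open>(\<mu> + max E)\<^sup>2\<close>, that is
  \<open>1 / log\<^sup>2 p\<close>.  Averaged over \<open>i\<close>, the growth is of order \<open>\<parallel>X\<parallel>\<^sup>2 / p \<cdot> (1 + \<bar>w\<^sub>j\<bar>\<^sup>2)\<close>, now with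
  \<open>w\<^sub>j = (G\<^sub>I - s Id)\<^sup>-\<^sup>1 v\<^sub>j\<close>.  The term \<open>\<bar>w\<^sub>j\<bar>\<^sup>2\<close> has no a priori bound, but it is also the derivative of
  \<open>E\<^sub>j\<close> in \<open>s\<close>: lowering \<open>s\<close> by a multiple of \<open>\<parallel>X\<parallel>\<^sup>2 / p\<close> in every step pays for it, and over \<open>S\<close>
  steps this costs only \<open>O(1 / log p)\<close>.  The shift never falls below \<open>1/2\<close>, so that positive
  definiteness of the shifted matrix is a uniform lower bound for \<open>G\<^sub>I\<close> and turns small energies into
  small coefficients (\<open>good_solution\<close>).  So the average of \<open>\<Sum>\<^sub>j exp (\<theta> E\<^sub>j)\<close> with \<open>\<theta>\<close> of order
  \<open>log\<^sup>2 p\<close>, truncated at the value where an energy might exceed \<open>\<tau>\<close> of order \<open>1 / log p\<close>, grows by a factor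
  that is a fixed power of \<open>p\<close>, while a failure contributes a much larger power (\<open>potential_step\<close>,
  \<open>card_bad_le\<close>).
\<close>

section \<open>Quadratic forms over finite index sets\<close>

definition qform :: "(nat \<Rightarrow> nat \<Rightarrow> real) \<Rightarrow> nat set \<Rightarrow> (nat \<Rightarrow> real) \<Rightarrow> real" where
  "qform M I x = (\<Sum>i\<in>I. \<Sum>l\<in>I. M i l * x i * x l)"

definition posdef :: "(nat \<Rightarrow> nat \<Rightarrow> real) \<Rightarrow> nat set \<Rightarrow> bool" where
  "posdef M I \<longleftrightarrow> (\<forall>x. (\<exists>i\<in>I. x i \<noteq> 0) \<longrightarrow> qform M I x > 0)"

definition solves :: "(nat \<Rightarrow> nat \<Rightarrow> real) \<Rightarrow> nat set \<Rightarrow> (nat \<Rightarrow> real) \<Rightarrow> (nat \<Rightarrow> real) \<Rightarrow> bool" where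
  "solves M I v w \<longleftrightarrow> (\<forall>i\<in>I. (\<Sum>l\<in>I. M i l * w l) = v i)"

definition solution :: "(nat \<Rightarrow> nat \<Rightarrow> real) \<Rightarrow> nat set \<Rightarrow> (nat \<Rightarrow> real) \<Rightarrow> nat \<Rightarrow> real" where
  "solution M I v = (SOME w. solves M I v w)"

text \<open>
  The quadratic form of the inverse, \<open>v\<^sup>T M\<^sup>-\<^sup>1 v\<close>, restricted to the rows and columns in \<open>I\<close>.
\<close>

definition energy :: "(nat \<Rightarrow> nat \<Rightarrow> real) \<Rightarrow> nat set \<Rightarrow> (nat \<Rightarrow> real) \<Rightarrow> real" where
  "energy M I v = (\<Sum>l\<in>I. v l * solution M I v l)"

definition symm :: "(nat \<Rightarrow> nat \<Rightarrow> real) \<Rightarrow> bool" where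
  "symm M \<longleftrightarrow> (\<forall>i l. M i l = M l i)"

definition diag_shift :: "(nat \<Rightarrow> nat \<Rightarrow> real) \<Rightarrow> real \<Rightarrow> nat \<Rightarrow> nat \<Rightarrow> real" where
  "diag_shift M s = (\<lambda>i l. M i l - (if i = l then s else 0))"

lemma posdef_nonneg: "posdef M I \<Longrightarrow> qform M I x \<ge> 0"
proof (cases "\<exists>i\<in>I. x i \<noteq> 0")
  case True
  assume "posdef M I"
  with True show ?thesis unfolding posdef_def by (meson less_imp_le)
next
  case False
  then show ?thesis unfolding qform_def by (auto intro!: sum_nonneg)
qed

lemma qform_add_solves:
  assumes M: "symm M" and w: "solves M I v w"
  shows "qform M I (\<lambda>i. x i + t * w i)
       = qform M I x + 2 * t * (\<Sum>i\<in>I. v i * x i) + t\<^sup>2 * (\<Sum>i\<in>I. v i * w i)"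
proof -
  have row: "(\<Sum>i\<in>I. \<Sum>l\<in>I. M i l * y i * w l) = (\<Sum>i\<in>I. v i * y i)" for y
  proof (rule sum.cong[OF refl])
    fix i assume i: "i \<in> I"
    have "(\<Sum>l\<in>I. M i l * y i * w l) = y i * (\<Sum>l\<in>I. M i l * w l)"
      by (simp add: sum_distrib_left mult_ac)
    then show "(\<Sum>l\<in>I. M i l * y i * w l) = v i * y i"
      using w i by (simp add: solves_def)
  qed
  have col: "(\<Sum>i\<in>I. \<Sum>l\<in>I. M i l * w i * y l) = (\<Sum>i\<in>I. v i * y i)" for y
    using row[of y] M unfolding symm_def
    by (subst sum.swap) (simp add: mult_ac)
  have "qform M I (\<lambda>i. x i + t * w i) =
      (\<Sum>i\<in>I. \<Sum>l\<in>I. M i l * x i * x l + t * (M i l * x i * w l)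
         + t * (M i l * w i * x l) + t\<^sup>2 * (M i l * w i * w l))"
    unfolding qform_def by (intro sum.cong refl) (simp add: algebra_simps power2_eq_square)
  also have "\<dots> = qform M I x + t * (\<Sum>i\<in>I. \<Sum>l\<in>I. M i l * x i * w l)
      + t * (\<Sum>i\<in>I. \<Sum>l\<in>I. M i l * w i * x l) + t\<^sup>2 * (\<Sum>i\<in>I. \<Sum>l\<in>I. M i l * w i * w l)"
    unfolding qform_def by (simp add: sum.distrib sum_distrib_left)
  finally show ?thesis unfolding row col by simp
qed

lemma qform_insert:
  assumes M: "symm M" and "finite I" "i \<notin> I"
  shows "qform M (insert i I) x = qform M I x + 2 * x i * (\<Sum>l\<in>I. M l i * x l) + M i i * (x i)\<^sup>2"
proof -
  have "qform M (insert i I) x = (M i i * x i * x i + (\<Sum>l\<in>I. M i l * x i * x l)) +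
     (\<Sum>k\<in>I. M k i * x k * x i + (\<Sum>l\<in>I. M k l * x k * x l))"
    unfolding qform_def using assms(2,3) by simp
  also have "(\<Sum>l\<in>I. M i l * x i * x l) = x i * (\<Sum>l\<in>I. M l i * x l)"
    using M unfolding symm_def sum_distrib_left by (intro sum.cong refl) (simp add: mult_ac)
  finally show ?thesis
    by (simp add: sum.distrib qform_def power2_eq_square sum_distrib_left mult_ac)
qed

text \<open>
  Completing the square in the new coordinate; the coefficient of \<open>(x i)\<^sup>2\<close> is the Schur
  complement, the pivot of Gaussian elimination.  The next lemmas read off from this identity how
  definiteness, solvability and energies change when an index is added.
\<close>

lemma qform_insert_complete_square:
  assumes M: "symm M" and I: "finite I" "i \<notin> I" and w: "solves M I (\<lambda>l. M l i) w"
  shows "qform M (insert i I) x = qform M I (\<lambda>l. x l + x i * w l)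
       + (M i i - (\<Sum>l\<in>I. M l i * w l)) * (x i)\<^sup>2"
  unfolding qform_insert[OF M I] qform_add_solves[OF M w] by (simp add: algebra_simps)

lemma posdef_subset:
  assumes "posdef M I" "J \<subseteq> I" "finite I"
  shows "posdef M J"
  unfolding posdef_def
proof (intro allI impI)
  fix x :: "nat \<Rightarrow> real" assume x: "\<exists>i\<in>J. x i \<noteq> 0"
  define y where "y i = (if i \<in> J then x i else 0)" for i
  have inner: "(\<Sum>l\<in>J. M i l * y i * y l) = (\<Sum>l\<in>I. M i l * y i * y l)" for i
    by (rule sum.mono_neutral_left) (use assms in \<open>auto simp: y_def\<close>)
  have "qform M J x = qform M J y" unfolding qform_def by (simp add: y_def)
  also have "\<dots> = (\<Sum>i\<in>J. \<Sum>l\<in>I. M i l * y i * y l)"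
    unfolding qform_def by (simp add: inner)
  also have "\<dots> = qform M I y" unfolding qform_def
    by (rule sum.mono_neutral_left) (use assms in \<open>auto simp: y_def\<close>)
  also have "\<dots> > 0"
  proof -
    have "\<exists>i\<in>I. y i \<noteq> 0" using x assms(2) by (auto simp: y_def)
    then show ?thesis using assms(1) by (simp add: posdef_def)
  qed
  finally show "qform M J x > 0" .
qed

lemma posdef_insertD:
  assumes M: "symm M" and I: "finite I" "i \<notin> I" and w: "solves M I (\<lambda>l. M l i) w"
    and pd: "posdef M (insert i I)"
  shows "M i i - (\<Sum>l\<in>I. M l i * w l) > 0"
proof -
  \<comment> \<open>The vector at which the completed square vanishes.\<close>
  define x where "x l = (if l = i then 1 else - w l)" for l
  have "qform M I (\<lambda>l. x l + x i * w l) = 0"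
    unfolding qform_def x_def using I by (intro sum.neutral ballI) auto
  then have "qform M (insert i I) x = M i i - (\<Sum>l\<in>I. M l i * w l)"
    unfolding qform_insert_complete_square[OF M I w] by (simp add: x_def)
  moreover have "qform M (insert i I) x > 0"
    using pd unfolding posdef_def by (auto simp: x_def)
  ultimately show ?thesis by simp
qed

lemma posdef_insertI:
  assumes M: "symm M" and I: "finite I" "i \<notin> I" and w: "solves M I (\<lambda>l. M l i) w"
    and pd: "posdef M I" and d: "M i i - (\<Sum>l\<in>I. M l i * w l) > 0"
  shows "posdef M (insert i I)"
  unfolding posdef_def
proof (intro allI impI)
  fix x :: "nat \<Rightarrow> real" assume x: "\<exists>l\<in>insert i I. x l \<noteq> 0"
  show "qform M (insert i I) x > 0"
  proof (cases "x i = 0")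
    case True
    with x pd show ?thesis
      unfolding qform_insert_complete_square[OF M I w] by (auto simp: posdef_def)
  next
    case False
    with d posdef_nonneg[OF pd] show ?thesis
      unfolding qform_insert_complete_square[OF M I w] by (simp add: add_nonneg_pos)
  qed
qed

text \<open>
  Dimensions vary here, so the solution is built by Gaussian elimination along \<open>I\<close>: the new pivot
  is positive, which determines the new coordinate, and the old ones are corrected by a multiple of
  the solution for the new column.
\<close>

lemma posdef_solvable:
  assumes "finite I" and M: "symm M" and "posdef M I"
  shows "\<exists>w. solves M I v w"
  using assms(1,3)
proof (induction I arbitrary: v)
  case empty
  then show ?case by (simp add: solves_def)
next
  case (insert i I)
  have pd: "posdef M I" using insert by (meson finite.insertI posdef_subset subset_insertI)
  obtain w where w: "solves M I (\<lambda>l. M l i) w" using insert.IH[OF pd] by blast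
  obtain u where u: "solves M I v u" using insert.IH[OF pd] by blast
  define d where "d = M i i - (\<Sum>l\<in>I. M l i * w l)"
  have d: "d > 0"
    using posdef_insertD[OF M _ _ w] insert unfolding d_def by blast
  define t where "t = (v i - (\<Sum>l\<in>I. M i l * u l)) / d"
  define y where "y l = (if l = i then t else u l - t * w l)" for l
  have sumy: "(\<Sum>l\<in>I. M k l * y l) = (\<Sum>l\<in>I. M k l * u l) - t * (\<Sum>l\<in>I. M k l * w l)" for k
  proof -
    have "(\<Sum>l\<in>I. M k l * y l) = (\<Sum>l\<in>I. M k l * u l - t * (M k l * w l))"
      using insert.hyps by (intro sum.cong refl) (auto simp: y_def algebra_simps)
    then show ?thesis by (simp add: sum_subtractf sum_distrib_left)
  qed
  have "solves M (insert i I) v y"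
    unfolding solves_def
  proof
    fix k assume k: "k \<in> insert i I"
    have *: "(\<Sum>l\<in>insert i I. M k l * y l) = M k i * t + (\<Sum>l\<in>I. M k l * u l) - t * (\<Sum>l\<in>I. M k l * w l)" for k
      using insert.hyps by (simp add: sumy) (simp add: y_def)
    show "(\<Sum>l\<in>insert i I. M k l * y l) = v k"
    proof (cases "k = i")
      case True
      have "(\<Sum>l\<in>I. M i l * w l) = M i i - d"
        using M by (simp add: d_def symm_def)
      have "(\<Sum>l\<in>insert i I. M k l * y l) = M i i * t + (\<Sum>l\<in>I. M i l * u l) - t * (M i i - d)"
        unfolding * True \<open>(\<Sum>l\<in>I. M i l * w l) = M i i - d\<close> ..
      then have "(\<Sum>l\<in>insert i I. M k l * y l) = t * d + (\<Sum>l\<in>I. M i l * u l)"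
        by (simp add: algebra_simps)
      then show ?thesis using d True by (simp add: t_def)
    next
      case False
      then have "k \<in> I" using k by simp
      then show ?thesis using w u unfolding * by (simp add: solves_def)
    qed
  qed
  then show ?case by blast
qed

lemma solves_solution:
  "finite I \<Longrightarrow> symm M \<Longrightarrow> posdef M I \<Longrightarrow> solves M I v (solution M I v)"
  unfolding solution_def by (rule someI_ex[OF posdef_solvable])

text \<open>
  Symmetry of the inverse matrix, stated without inverting.
\<close>

lemma solves_symmetric:
  assumes M: "symm M" and a: "solves M I u a" and b: "solves M I v b"
  shows "(\<Sum>l\<in>I. u l * b l) = (\<Sum>l\<in>I. v l * a l)"
proof -
  have "(\<Sum>l\<in>I. u l * b l) = (\<Sum>l\<in>I. \<Sum>k\<in>I. M l k * a k * b l)"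
    using a unfolding solves_def sum_distrib_right[symmetric] by (intro sum.cong refl) simp
  also have "\<dots> = (\<Sum>k\<in>I. \<Sum>l\<in>I. M l k * a k * b l)" by (rule sum.swap)
  also have "\<dots> = (\<Sum>k\<in>I. (\<Sum>l\<in>I. M k l * b l) * a k)"
    using M unfolding sum_distrib_right symm_def by (intro sum.cong refl) (simp add: mult_ac)
  also have "\<dots> = (\<Sum>k\<in>I. v k * a k)"
    using b unfolding solves_def by (intro sum.cong refl) simp
  finally show ?thesis .
qed

lemma qform_eq_sum_rows: "qform M I x = (\<Sum>i\<in>I. (\<Sum>l\<in>I. M i l * x l) * x i)"
  unfolding qform_def sum_distrib_right by (intro sum.cong refl) (simp add: mult_ac)

lemma qform_solves:
  assumes "solves M I v w"
  shows "qform M I w = (\<Sum>l\<in>I. v l * w l)"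
  using assms unfolding qform_eq_sum_rows solves_def by (intro sum.cong refl) simp

lemma energy_cong: "(\<And>l. l \<in> I \<Longrightarrow> u l = v l) \<Longrightarrow> energy M I u = energy M I v"
proof -
  assume *: "\<And>l. l \<in> I \<Longrightarrow> u l = v l"
  then have "solves M I u = solves M I v" by (auto simp: solves_def fun_eq_iff)
  then show ?thesis using * by (simp add: energy_def solution_def)
qed

text \<open>
  The concave function on the left has its maximum at the solution, where it equals the energy.
  This makes energies comparable for different matrices and index sets: a maximiser of one
  problem is a competitor in the other.
\<close>

lemma energy_variational:
  assumes "finite I" "symm M" "posdef M I"
  shows "2 * (\<Sum>l\<in>I. v l * x l) - qform M I x \<le> energy M I v"
proof -
  have "0 \<le> qform M I (\<lambda>l. x l + (-1) * solution M I v l)"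
    by (rule posdef_nonneg) fact
  then show ?thesis
    unfolding qform_add_solves[OF assms(2) solves_solution[OF assms]] energy_def by simp
qed

lemma energy_eq:
  assumes "finite I" "symm M" "posdef M I"
  shows "energy M I v = 2 * (\<Sum>l\<in>I. v l * solution M I v l) - qform M I (solution M I v)"
  unfolding qform_solves[OF solves_solution[OF assms]] energy_def by simp

text \<open>
  Cauchy--Schwarz together with the arithmetic-geometric mean inequality, for the inner product
  given by the inverse matrix.
\<close>

lemma cross_energy_le:
  assumes "finite I" "symm M" "posdef M I"
  shows "\<bar>\<Sum>l\<in>I. u l * solution M I v l\<bar> \<le> (energy M I u + energy M I v) / 2"
proof -
  have 1: "0 \<le> qform M I (\<lambda>l. solution M I v l + t * solution M I u l)" for t
    by (rule posdef_nonneg) fact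
  have 2: "qform M I (solution M I v) = energy M I v"
    unfolding energy_def by (rule qform_solves[OF solves_solution[OF assms]])
  have "0 \<le> energy M I v + 2 * t * (\<Sum>l\<in>I. u l * solution M I v l) + t\<^sup>2 * energy M I u" for t
    using 1[of t] unfolding qform_add_solves[OF assms(2) solves_solution[OF assms]] 2
    by (simp add: energy_def)
  from this[of 1] this[of "-1"] show ?thesis by (simp add: abs_le_iff)
qed

text \<open>
  The maximiser for the larger set is \<open>x - t w\<close> on \<open>I\<close> and \<open>t\<close> at \<open>i\<close>, where \<open>w\<close> solves for the new
  column.  After completing the square, the old energy bounds the part in \<open>x\<close>, and the part in
  \<open>t\<close> is a parabola with the given maximum.
\<close>

lemma energy_insert_le:
  assumes M: "symm M" and I: "finite I" "i \<notin> I" and pd: "posdef M I"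
    and d: "energy M I (\<lambda>l. M l i) < M i i"
  shows "energy M (insert i I) v \<le> energy M I v +
     (v i - (\<Sum>l\<in>I. M i l * solution M I v l))\<^sup>2 / (M i i - energy M I (\<lambda>l. M l i))"
proof -
  define w where "w = solution M I (\<lambda>l. M l i)"
  define \<delta> where "\<delta> = M i i - energy M I (\<lambda>l. M l i)"
  have w: "solves M I (\<lambda>l. M l i) w"
    unfolding w_def by (rule solves_solution[OF I(1) M pd])
  have \<delta>: "\<delta> = M i i - (\<Sum>l\<in>I. M l i * w l)" by (simp add: \<delta>_def energy_def w_def)
  have pos: "\<delta> > 0" using d by (simp add: \<delta>_def)
  have pd': "posdef M (insert i I)"
    using posdef_insertI[OF M I w pd] pos by (simp add: \<delta>)
  define y where "y = solution M (insert i I) v"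
  define t where "t = y i"
  define x where "x l = y l + t * w l" for l
  define c where "c = v i - (\<Sum>l\<in>I. v l * w l)"
  have swap: "(\<Sum>l\<in>I. v l * w l) = (\<Sum>l\<in>I. M i l * solution M I v l)"
    using solves_symmetric[OF M solves_solution[OF I(1) M pd] w] M by (simp add: symm_def)
  have "energy M (insert i I) v = 2 * (\<Sum>l\<in>insert i I. v l * y l) - qform M (insert i I) y"
    using energy_eq[OF _ M pd'] I unfolding y_def by simp
  also have "\<dots> = 2 * (\<Sum>l\<in>I. v l * y l) + 2 * v i * t - qform M I x - \<delta> * t\<^sup>2"
    using I unfolding qform_insert_complete_square[OF M I w] \<delta>
    by (simp add: x_def[abs_def] t_def)
  also have "(\<Sum>l\<in>I. v l * y l) = (\<Sum>l\<in>I. v l * x l) - t * (\<Sum>l\<in>I. v l * w l)"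
    unfolding x_def by (simp add: distrib_left sum.distrib sum_distrib_left mult_ac)
  also have "2 * ((\<Sum>l\<in>I. v l * x l) - t * (\<Sum>l\<in>I. v l * w l)) + 2 * v i * t - qform M I x - \<delta> * t\<^sup>2
     = (2 * (\<Sum>l\<in>I. v l * x l) - qform M I x) + (2 * t * c - \<delta> * t\<^sup>2)"
    by (simp add: c_def algebra_simps)
  also have "\<dots> \<le> energy M I v + c\<^sup>2 / \<delta>"
  proof (rule add_mono)
    show "2 * (\<Sum>l\<in>I. v l * x l) - qform M I x \<le> energy M I v"
      by (rule energy_variational[OF I(1) M pd])
    have "0 \<le> (c - \<delta> * t)\<^sup>2 / \<delta>" using pos by simp
    also have "\<dots> = c\<^sup>2 / \<delta> - (2 * t * c - \<delta> * t\<^sup>2)"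
      using pos by (simp add: field_simps power2_eq_square)
    finally show "2 * t * c - \<delta> * t\<^sup>2 \<le> c\<^sup>2 / \<delta>" by simp
  qed
  finally show ?thesis unfolding c_def \<delta>_def swap .
qed

lemma symm_diag_shift: "symm M \<Longrightarrow> symm (diag_shift M s)"
  by (auto simp: symm_def diag_shift_def)

lemma diag_shift_sum:
  assumes "finite I" "i \<in> I"
  shows "(\<Sum>l\<in>I. diag_shift M s i l * w l) = (\<Sum>l\<in>I. M i l * w l) - s * w i"
proof -
  have "(\<Sum>l\<in>I. diag_shift M s i l * w l) = (\<Sum>l\<in>I. M i l * w l - (if l = i then s * w l else 0))"
    by (intro sum.cong refl) (auto simp: diag_shift_def algebra_simps)
  then show ?thesis using assms by (simp add: sum_subtractf)
qed

lemma qform_diag_shift: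
  assumes "finite I"
  shows "qform (diag_shift M s) I x = qform M I x - s * (\<Sum>l\<in>I. (x l)\<^sup>2)"
proof -
  have "qform (diag_shift M s) I x = (\<Sum>i\<in>I. (\<Sum>l\<in>I. M i l * x l) * x i - s * (x i)\<^sup>2)"
    unfolding qform_eq_sum_rows using assms
    by (intro sum.cong refl) (simp add: diag_shift_sum left_diff_distrib power2_eq_square)
  then show ?thesis
    by (simp add: sum_subtractf sum_distrib_left qform_eq_sum_rows)
qed

lemma posdef_diag_shift_mono:
  assumes "finite I" "posdef (diag_shift M s) I" "s' \<le> s"
  shows "posdef (diag_shift M s') I"
  unfolding posdef_def
proof (intro allI impI)
  fix x :: "nat \<Rightarrow> real" assume "\<exists>i\<in>I. x i \<noteq> 0"
  then have "0 < qform (diag_shift M s) I x" using assms(2) by (simp add: posdef_def)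
  moreover have "s' * (\<Sum>l\<in>I. (x l)\<^sup>2) \<le> s * (\<Sum>l\<in>I. (x l)\<^sup>2)"
    using assms(3) by (intro mult_right_mono sum_nonneg) auto
  ultimately show "0 < qform (diag_shift M s') I x"
    using assms(1) by (simp add: qform_diag_shift)
qed

text \<open>
  The gain from lowering the shift: the solution for the smaller shift competes in the variational
  problem for the larger one, and its value there exceeds its own energy by \<open>(s - s') \<bar>w\<bar>\<^sup>2\<close>.
\<close>

lemma energy_diag_shift_le:
  assumes I: "finite I" and M: "symm M" and pd: "posdef (diag_shift M s) I" and s: "s' \<le> s"
  shows "energy (diag_shift M s') I v
       + (s - s') * (\<Sum>l\<in>I. (solution (diag_shift M s') I v l)\<^sup>2) \<le> energy (diag_shift M s) I v"
proof -
  define w where "w = solution (diag_shift M s') I v"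
  have "energy (diag_shift M s') I v = 2 * (\<Sum>l\<in>I. v l * w l) - qform (diag_shift M s') I w"
    unfolding w_def by (rule energy_eq[OF I symm_diag_shift[OF M] posdef_diag_shift_mono[OF I pd s]])
  also have "qform (diag_shift M s') I w = qform (diag_shift M s) I w + (s - s') * (\<Sum>l\<in>I. (w l)\<^sup>2)"
    using I by (simp add: qform_diag_shift algebra_simps)
  finally show ?thesis
    using energy_variational[OF I symm_diag_shift[OF M] pd, of v w] by (simp add: w_def)
qed

section \<open>Uniformly random subsets and the moving barrier\<close>

definition subsets_of_card :: "nat \<Rightarrow> nat \<Rightarrow> nat set set" where
  "subsets_of_card p k = {J. J \<subseteq> {..<p} \<and> card J = k}"

lemma finite_subsets_of_card [simp]: "finite (subsets_of_card p k)"
  unfolding subsets_of_card_def by (rule finite_subset[of _ "Pow {..<p}"]) auto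

lemma card_subsets_of_card: "card (subsets_of_card p k) = p choose k"
  unfolding subsets_of_card_def using n_subsets[of "{..<p}" k] by simp

text \<open>
  Double counting of the pairs of a \<open>k\<close>-set and a further element.  It says that a uniformly random
  \<open>(k+1)\<close>-set arises by adding a uniformly random new element to a uniformly random \<open>k\<close>-set.
\<close>

lemma sum_add_element_eq_sum_remove_element:
  fixes F :: "nat \<Rightarrow> nat set \<Rightarrow> real"
  shows "(\<Sum>J\<in>subsets_of_card p k. \<Sum>i\<in>{..<p} - J. F i J)
       = (\<Sum>J\<in>subsets_of_card p (Suc k). \<Sum>i\<in>J. F i (J - {i}))"
proof -
  have fin: "finite J" if "J \<in> subsets_of_card p m" for J m
    using that finite_subset unfolding subsets_of_card_def by blast
  have "(\<Sum>J\<in>subsets_of_card p k. \<Sum>i\<in>{..<p} - J. F i J)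
      = (\<Sum>(J, i)\<in>Sigma (subsets_of_card p k) (\<lambda>J. {..<p} - J). F i J)"
    by (rule sum.Sigma) auto
  also have "\<dots> = (\<Sum>(J, i)\<in>Sigma (subsets_of_card p (Suc k)) (\<lambda>J. J). F i (J - {i}))"
    by (rule sum.reindex_bij_witness[where i = "\<lambda>(J, i). (J - {i}, i)" and j = "\<lambda>(J, i). (insert i J, i)"])
      (auto simp: subsets_of_card_def card_insert_if finite_subset insert_absorb)
  also have "\<dots> = (\<Sum>J\<in>subsets_of_card p (Suc k). \<Sum>i\<in>J. F i (J - {i}))"
    by (rule sum.Sigma[symmetric]) (auto intro: fin)
  finally show ?thesis .
qed

lemma exp_le_one_plus_double: "0 \<le> (x::real) \<Longrightarrow> x \<le> 1 \<Longrightarrow> exp x \<le> 1 + 2 * x"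
  using exp_bound[of x] power_le_one_iff mult_left_le[of x x] by (simp add: power2_eq_square)

text \<open>
  The matrix \<open>g\<close> plays the part of a Gram matrix \<open>X\<^sup>T X\<close> and \<open>L\<close> that of \<open>\<parallel>X\<parallel>\<^sup>2\<close>; the assumption
  on squares is \<open>g\<^sup>2 \<le> L g\<close>.  The last assumption keeps a single increment of \<open>\<theta> E\<close> at most one, so that the
  exponential may be linearised.
\<close>

locale barrier =
  fixes g :: "nat \<Rightarrow> nat \<Rightarrow> real" and p :: nat and L \<mu> \<theta> \<tau> :: real
  assumes symm_g: "symm g"
    and diag: "\<And>i. i < p \<Longrightarrow> g i i = 1"
    and offdiag: "\<And>i j. i < p \<Longrightarrow> j < p \<Longrightarrow> i \<noteq> j \<Longrightarrow> \<bar>g i j\<bar> \<le> \<mu>"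
    and gram_square: "\<And>x. (\<Sum>i<p. (\<Sum>l<p. g i l * x l)\<^sup>2) \<le> L * qform g {..<p} x"
    and L_nonneg: "L \<ge> 0"
    and \<theta>_pos: "\<theta> > 0" and \<tau>_le: "\<tau> \<le> 1 / 8"
    and small_jump: "8 * \<theta> * (\<mu> + \<tau>)\<^sup>2 \<le> 1"
begin

definition \<eta> :: real where "\<eta> = 32 * L / real p"

text \<open>
  The start \<open>3/4\<close> leaves diagonal entries of at least \<open>1/4\<close>, hence pivots of at least \<open>1/8\<close> once energies
  are at most \<open>1/8\<close>; only shifts of at least \<open>1/2\<close> will be used.
\<close>

definition shift :: "nat \<Rightarrow> real" where "shift k = 3 / 4 - real k * \<eta>"

definition en :: "nat \<Rightarrow> nat set \<Rightarrow> nat \<Rightarrow> real" where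
  "en k I j = energy (diag_shift g (shift k)) I (\<lambda>l. g l j)"

definition pot :: "nat \<Rightarrow> nat set \<Rightarrow> real" where
  "pot k I = (\<Sum>j\<in>{..<p} - I. exp (\<theta> * en k I j))"

definition good :: "nat \<Rightarrow> nat set \<Rightarrow> bool" where
  "good k I \<longleftrightarrow> posdef (diag_shift g (shift k)) I \<and> pot k I \<le> exp (\<theta> * \<tau>)"

text \<open>
  Truncating at \<open>exp (\<theta> \<tau>)\<close> turns the potential into a function of the set alone: from a bad set it
  cannot increase, whatever happens later, so it is a supermartingale up to a constant factor
  without a stopping time.
\<close>

definition \<Phi> :: "nat \<Rightarrow> nat set \<Rightarrow> real" where
  "\<Phi> k I = (if good k I then pot k I else exp (\<theta> * \<tau>))"

lemma \<eta>_nonneg: "\<eta> \<ge> 0" using L_nonneg by (simp add: \<eta>_def)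

lemma good_en_le:
  assumes "good k I" "j < p" "j \<notin> I"
  shows "en k I j \<le> \<tau>"
proof -
  have "exp (\<theta> * en k I j) \<le> pot k I"
    unfolding pot_def by (rule member_le_sum) (use assms in auto)
  also have "\<dots> \<le> exp (\<theta> * \<tau>)" using assms(1) by (simp add: good_def)
  finally show ?thesis using \<theta>_pos by simp
qed

lemma \<Phi>_nonneg: "\<Phi> k I \<ge> 0"
  by (simp add: \<Phi>_def pot_def sum_nonneg)

lemma \<Phi>_le: "\<Phi> k I \<le> exp (\<theta> * \<tau>)"
  by (simp add: \<Phi>_def good_def)

text \<open>
  With \<open>w = (g - s Id)\<^sup>-\<^sup>1 v\<^sub>j\<close>, the left side is \<open>\<bar>g x\<bar>\<^sup>2\<close> for the vector \<open>x = e\<^sub>j - w\<close>.  So it is at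
  most \<open>L x\<^sup>T g x\<close>, and \<open>x\<^sup>T g x = 1 - E\<^sub>j + s \<bar>w\<bar>\<^sup>2\<close>.
\<close>

lemma residual_sum_le:
  assumes I: "I \<subseteq> {..<p}" and j: "j < p" "j \<notin> I" and w: "solves (diag_shift g s) I (\<lambda>l. g l j) w"
    and pd: "posdef (diag_shift g s) I" and s: "0 \<le> s" "s \<le> 1"
  shows "(\<Sum>i<p. (g i j - (\<Sum>l\<in>I. g i l * w l))\<^sup>2) \<le> L * (1 + (\<Sum>l\<in>I. (w l)\<^sup>2))"
proof -
  have fin: "finite I" using I finite_subset by blast
  define x where "x l = (if l = j then 1 else if l \<in> I then - w l else 0)" for l
  have row: "(\<Sum>l<p. g i l * x l) = g i j - (\<Sum>l\<in>I. g i l * w l)" for i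
  proof -
    have "(\<Sum>l<p. g i l * x l) = (\<Sum>l\<in>insert j I. g i l * x l)"
      by (rule sum.mono_neutral_right) (use I j in \<open>auto simp: x_def\<close>)
    also have "\<dots> = g i j + (\<Sum>l\<in>I. g i l * x l)" using j fin by (simp add: x_def)
    also have "(\<Sum>l\<in>I. g i l * x l) = (\<Sum>l\<in>I. - (g i l * w l))"
      by (rule sum.cong) (use j in \<open>auto simp: x_def\<close>)
    finally show ?thesis by (simp add: sum_negf)
  qed
  have "qform g {..<p} x = (\<Sum>i<p. (g i j - (\<Sum>l\<in>I. g i l * w l)) * x i)"
    by (simp add: qform_eq_sum_rows row)
  also have "\<dots> = (\<Sum>i\<in>insert j I. (g i j - (\<Sum>l\<in>I. g i l * w l)) * x i)"
    by (rule sum.mono_neutral_right) (use I j in \<open>auto simp: x_def\<close>)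
  also have "\<dots> = (1 - (\<Sum>l\<in>I. g j l * w l)) + (\<Sum>i\<in>I. (g i j - (\<Sum>l\<in>I. g i l * w l)) * x i)"
    using j fin diag by (simp add: x_def)
  also have "(\<Sum>i\<in>I. (g i j - (\<Sum>l\<in>I. g i l * w l)) * x i) = (\<Sum>i\<in>I. s * (w i)\<^sup>2)"
  proof (rule sum.cong[OF refl])
    fix i assume i: "i \<in> I"
    have "(\<Sum>l\<in>I. g i l * w l) - s * w i = g i j"
      using w i diag_shift_sum[OF fin i, of g s w] by (auto simp: solves_def)
    then show "(g i j - (\<Sum>l\<in>I. g i l * w l)) * x i = s * (w i)\<^sup>2"
      using i j by (auto simp: x_def power2_eq_square algebra_simps)
  qed
  also have "(\<Sum>l\<in>I. g j l * w l) = qform (diag_shift g s) I w"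
    using symm_g unfolding qform_solves[OF w] symm_def by (intro sum.cong refl) simp
  finally have "qform g {..<p} x = 1 - qform (diag_shift g s) I w + s * (\<Sum>i\<in>I. (w i)\<^sup>2)"
    by (simp add: sum_distrib_left)
  moreover have "s * (\<Sum>i\<in>I. (w i)\<^sup>2) \<le> 1 * (\<Sum>i\<in>I. (w i)\<^sup>2)"
    by (rule mult_right_mono) (use s in \<open>auto intro: sum_nonneg\<close>)
  ultimately have "qform g {..<p} x \<le> 1 + (\<Sum>i\<in>I. (w i)\<^sup>2)"
    using posdef_nonneg[OF pd, of w] by simp
  then have "L * qform g {..<p} x \<le> L * (1 + (\<Sum>i\<in>I. (w i)\<^sup>2))"
    using L_nonneg by (rule mult_left_mono)
  then show ?thesis using gram_square[of x] by (simp add: row)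
qed

text \<open>
  The core of the argument: first lower the shift, which decreases each energy by
  \<open>\<eta> \<bar>w\<^sub>j\<bar>\<^sup>2\<close>, then add the random element.  Each energy increment is at most eight times the square
  of \<open>y i j\<close> because the pivot is at least \<open>1/8\<close>; it is small in the worst case (\<open>y_le\<close>), which
  allows linearising the exponential, and its average over \<open>i\<close> is compensated by the gain up to
  the factor \<open>exp (32 \<theta> L / p)\<close>.
\<close>

lemma potential_step_good:
  assumes I: "I \<subseteq> {..<p}" "card I = k" and k: "2 * k < p" and sh: "0 \<le> shift (Suc k)"
    and good: "good k I"
  shows "(\<Sum>i\<in>{..<p} - I. \<Phi> (Suc k) (insert i I)) \<le> real (p - k) * exp (32 * \<theta> * L / real p) * \<Phi> k I"
proof -
  have fin: "finite I" using I finite_subset by blast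
  define J where "J = {..<p} - I"
  have J: "finite J" "card J = p - k" using I card_Diff_subset[OF fin I(1)] by (auto simp: J_def)
  define s where "s = shift (Suc k)"
  define M where "M = diag_shift g s"
  define E where "E j = energy M I (\<lambda>l. g l j)" for j
  define w where "w j = solution M I (\<lambda>l. g l j)" for j
  define y where "y i j = g i j - (\<Sum>l\<in>I. g i l * w j l)" for i j
  have s: "s \<le> 3 / 4" "0 \<le> s" "s = shift k - \<eta>" "s \<le> shift k"
    using \<eta>_nonneg sh by (auto simp: s_def shift_def algebra_simps)
  have pd0: "posdef (diag_shift g (shift k)) I" using good by (simp add: good_def)
  have M: "symm M" unfolding M_def by (rule symm_diag_shift[OF symm_g])
  have pd: "posdef M I" unfolding M_def by (rule posdef_diag_shift_mono[OF fin pd0 s(4)])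
  have shift_gain: "E j + \<eta> * (\<Sum>l\<in>I. (w j l)\<^sup>2) \<le> en k I j" for j
    using energy_diag_shift_le[OF fin symm_g pd0 s(4), of "\<lambda>l. g l j"] s(3)
    by (simp add: E_def w_def M_def en_def)
  have E_le: "E j \<le> \<tau>" if "j \<in> J" for j
  proof -
    have "0 \<le> \<eta> * (\<Sum>l\<in>I. (w j l)\<^sup>2)" using \<eta>_nonneg by (simp add: sum_nonneg)
    then show ?thesis using shift_gain[of j] good_en_le[OF good, of j] that by (simp add: J_def)
  qed
  have offrow: "M i l = g i l" "M l i = g l i" if "i \<in> J" "l \<in> I" for i l
    using that by (auto simp: M_def diag_shift_def J_def)
  have piv: "M i i - energy M I (\<lambda>l. M l i) \<ge> 1 / 8" if i: "i \<in> J" for i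
  proof -
    have "energy M I (\<lambda>l. M l i) = E i"
      unfolding E_def by (rule energy_cong) (simp add: offrow[OF i])
    moreover have "M i i = 1 - s" using i diag by (simp add: M_def diag_shift_def J_def)
    ultimately show ?thesis using E_le[OF i] \<tau>_le s by simp
  qed
  have y_le: "8 * \<theta> * (y i j)\<^sup>2 \<le> 1" if "i \<in> J" "j \<in> J" "i \<noteq> j" for i j
  proof -
    have "\<bar>\<Sum>l\<in>I. g i l * w j l\<bar> \<le> (energy M I (\<lambda>l. g i l) + E j) / 2"
      unfolding w_def E_def by (rule cross_energy_le[OF fin M pd])
    also have "energy M I (\<lambda>l. g i l) = E i"
      unfolding E_def by (rule energy_cong) (use symm_g in \<open>simp add: symm_def\<close>)
    finally have "\<bar>y i j\<bar> \<le> \<mu> + \<tau>"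
      using E_le[OF that(1)] E_le[OF that(2)] offdiag[of i j] that unfolding y_def J_def by auto
    then have "(y i j)\<^sup>2 \<le> (\<mu> + \<tau>)\<^sup>2" by (metis abs_ge_zero power2_abs power_mono)
    then have "8 * \<theta> * (y i j)\<^sup>2 \<le> 8 * \<theta> * (\<mu> + \<tau>)\<^sup>2" using \<theta>_pos by (intro mult_left_mono) auto
    then show ?thesis using small_jump by simp
  qed
  have jump: "exp (\<theta> * en (Suc k) (insert i I) j) \<le> exp (\<theta> * E j) * (1 + 16 * \<theta> * (y i j)\<^sup>2)"
    if "i \<in> J" "j \<in> J" "i \<noteq> j" for i j
  proof -
    have i: "i \<notin> I" using that by (simp add: J_def)
    have "en (Suc k) (insert i I) j \<le> energy M I (\<lambda>l. g l j) +
        (g i j - (\<Sum>l\<in>I. M i l * w j l))\<^sup>2 / (M i i - energy M I (\<lambda>l. M l i))"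
      unfolding en_def w_def s_def[symmetric] M_def[symmetric]
      by (rule energy_insert_le[OF M fin i pd]) (use piv[OF that(1)] in simp)
    also have "(\<Sum>l\<in>I. M i l * w j l) = (\<Sum>l\<in>I. g i l * w j l)"
      by (intro sum.cong refl) (simp add: offrow[OF that(1)])
    also have "(g i j - (\<Sum>l\<in>I. g i l * w j l))\<^sup>2 / (M i i - energy M I (\<lambda>l. M l i))
       \<le> (y i j)\<^sup>2 / (1 / 8)"
      unfolding y_def by (rule divide_left_mono) (use piv[OF that(1)] in auto)
    finally have "\<theta> * en (Suc k) (insert i I) j \<le> \<theta> * (E j + 8 * (y i j)\<^sup>2)"
      using \<theta>_pos by (intro mult_left_mono) (auto simp: E_def)
    then have "exp (\<theta> * en (Suc k) (insert i I) j) \<le> exp (\<theta> * E j + 8 * \<theta> * (y i j)\<^sup>2)"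
      by (simp add: algebra_simps)
    also have "\<dots> = exp (\<theta> * E j) * exp (8 * \<theta> * (y i j)\<^sup>2)" by (rule exp_add)
    also have "\<dots> \<le> exp (\<theta> * E j) * (1 + 2 * (8 * \<theta> * (y i j)\<^sup>2))"
      using \<theta>_pos y_le[OF that] by (intro mult_left_mono exp_le_one_plus_double) auto
    finally show ?thesis by (simp add: mult.assoc)
  qed
  have \<Phi>_le_pot: "\<Phi> (Suc k) (insert i I) \<le> (\<Sum>j\<in>J. exp (\<theta> * E j) * (1 + 16 * \<theta> * (y i j)\<^sup>2))"
    if i: "i \<in> J" for i
  proof -
    have w': "solves M I (\<lambda>l. M l i) (solution M I (\<lambda>l. M l i))"
      by (rule solves_solution[OF fin M pd])
    have "posdef M (insert i I)"
      by (rule posdef_insertI[OF M fin _ w' pd])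
        (use i piv[OF i] in \<open>auto simp: J_def energy_def\<close>)
    then have "\<Phi> (Suc k) (insert i I) \<le> pot (Suc k) (insert i I)"
      by (auto simp: \<Phi>_def good_def M_def s_def)
    also have "\<dots> = (\<Sum>j\<in>J - {i}. exp (\<theta> * en (Suc k) (insert i I) j))"
      unfolding pot_def J_def by (rule sum.cong) auto
    also have "\<dots> \<le> (\<Sum>j\<in>J - {i}. exp (\<theta> * E j) * (1 + 16 * \<theta> * (y i j)\<^sup>2))"
      by (rule sum_mono) (use i in \<open>auto intro!: jump\<close>)
    also have "\<dots> \<le> (\<Sum>j\<in>J. exp (\<theta> * E j) * (1 + 16 * \<theta> * (y i j)\<^sup>2))"
      by (rule sum_mono2) (use J \<theta>_pos in \<open>auto intro!: mult_nonneg_nonneg add_nonneg_nonneg\<close>)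
    finally show ?thesis .
  qed
  have average: "(\<Sum>i\<in>J. 1 + 16 * \<theta> * (y i j)\<^sup>2)
      \<le> real (p - k) * exp (32 * \<theta> * L / real p * (1 + (\<Sum>l\<in>I. (w j l)\<^sup>2)))" if j: "j \<in> J" for j
  proof -
    define W where "W = 1 + (\<Sum>l\<in>I. (w j l)\<^sup>2)"
    have W: "W \<ge> 0" by (simp add: W_def sum_nonneg add_nonneg_nonneg)
    have "(\<Sum>i\<in>J. (y i j)\<^sup>2) \<le> (\<Sum>i<p. (y i j)\<^sup>2)"
      by (rule sum_mono2) (auto simp: J_def)
    also have "\<dots> \<le> L * W" unfolding y_def W_def
      by (rule residual_sum_le[OF I(1) _ _ _ pd[unfolded M_def]])
        (use j s solves_solution[OF fin M pd] in \<open>auto simp: J_def M_def w_def\<close>)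
    finally have "16 * \<theta> * (\<Sum>i\<in>J. (y i j)\<^sup>2) \<le> 16 * \<theta> * (L * W)"
      using \<theta>_pos by (intro mult_left_mono) auto
    also have "16 * \<theta> * (L * W) \<le> real (p - k) * (32 * \<theta> * L / real p * W)"
    proof -
      have "real p * (16 * \<theta> * L * W) \<le> (2 * real (p - k)) * (16 * \<theta> * L * W)"
        using k \<theta>_pos L_nonneg W by (intro mult_right_mono) auto
      then show ?thesis using k by (simp add: field_simps)
    qed
    finally have "(\<Sum>i\<in>J. 1 + 16 * \<theta> * (y i j)\<^sup>2) \<le> real (p - k) * (1 + 32 * \<theta> * L / real p * W)"
      by (simp add: sum.distrib J sum_distrib_left distrib_left)
    also have "\<dots> \<le> real (p - k) * exp (32 * \<theta> * L / real p * W)"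
      by (intro mult_left_mono exp_ge_add_one_self) auto
    finally show ?thesis by (simp add: W_def)
  qed
  have "(\<Sum>i\<in>J. \<Phi> (Suc k) (insert i I))
      \<le> (\<Sum>i\<in>J. \<Sum>j\<in>J. exp (\<theta> * E j) * (1 + 16 * \<theta> * (y i j)\<^sup>2))"
    by (rule sum_mono) (rule \<Phi>_le_pot)
  also have "\<dots> = (\<Sum>j\<in>J. exp (\<theta> * E j) * (\<Sum>i\<in>J. 1 + 16 * \<theta> * (y i j)\<^sup>2))"
    unfolding sum_distrib_left by (rule sum.swap)
  also have "\<dots> \<le> (\<Sum>j\<in>J. exp (\<theta> * E j) *
      (real (p - k) * exp (32 * \<theta> * L / real p * (1 + (\<Sum>l\<in>I. (w j l)\<^sup>2)))))"
    by (intro sum_mono mult_left_mono average) auto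
  \<comment> \<open>Moving the barrier by \<open>\<eta>\<close> has paid for the quadratic term of the average.\<close>
  also have "\<dots> \<le> (\<Sum>j\<in>J. real (p - k) * exp (32 * \<theta> * L / real p) * exp (\<theta> * en k I j))"
  proof (rule sum_mono)
    fix j assume "j \<in> J"
    have "\<theta> * E j + 32 * \<theta> * L / real p * (1 + (\<Sum>l\<in>I. (w j l)\<^sup>2))
        = 32 * \<theta> * L / real p + \<theta> * (E j + \<eta> * (\<Sum>l\<in>I. (w j l)\<^sup>2))"
      by (simp add: \<eta>_def algebra_simps add_divide_distrib)
    also have "\<dots> \<le> 32 * \<theta> * L / real p + \<theta> * en k I j"
      using shift_gain[of j] \<theta>_pos by simp
    finally have "exp (\<theta> * E j) * exp (32 * \<theta> * L / real p * (1 + (\<Sum>l\<in>I. (w j l)\<^sup>2)))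
        \<le> exp (32 * \<theta> * L / real p) * exp (\<theta> * en k I j)"
      by (simp flip: exp_add)
    then show "exp (\<theta> * E j) * (real (p - k) * exp (32 * \<theta> * L / real p * (1 + (\<Sum>l\<in>I. (w j l)\<^sup>2))))
        \<le> real (p - k) * exp (32 * \<theta> * L / real p) * exp (\<theta> * en k I j)"
      by (simp add: mult.assoc mult.left_commute mult_left_mono)
  qed
  also have "\<dots> = real (p - k) * exp (32 * \<theta> * L / real p) * \<Phi> k I"
    using good by (simp add: \<Phi>_def pot_def J_def sum_distrib_left)
  finally show ?thesis by (simp add: J_def)
qed

lemma potential_step:
  assumes I: "I \<subseteq> {..<p}" "card I = k" and k: "2 * k < p" and sh: "0 \<le> shift (Suc k)"
  shows "(\<Sum>i\<in>{..<p} - I. \<Phi> (Suc k) (insert i I)) \<le> real (p - k) * exp (32 * \<theta> * L / real p) * \<Phi> k I"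
proof (cases "good k I")
  case True
  then show ?thesis by (rule potential_step_good[OF assms])
next
  case False
  have fin: "finite I" using I finite_subset by blast
  have "(\<Sum>i\<in>{..<p} - I. \<Phi> (Suc k) (insert i I)) \<le> (\<Sum>i\<in>{..<p} - I. \<Phi> k I)"
    using False \<Phi>_le by (intro sum_mono) (simp add: \<Phi>_def[of k])
  also have "\<dots> = real (p - k) * 1 * \<Phi> k I"
    using card_Diff_subset[OF fin I(1)] I by simp
  also have "\<dots> \<le> real (p - k) * exp (32 * \<theta> * L / real p) * \<Phi> k I"
    using \<theta>_pos L_nonneg \<Phi>_nonneg by (intro mult_right_mono mult_left_mono) auto
  finally show ?thesis .
qed

lemma average_potential_le:
  assumes "2 * k \<le> p" "p > 0" "0 \<le> shift k"
  shows "(\<Sum>I\<in>subsets_of_card p k. \<Phi> k I)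
    \<le> real (p choose k) * (real p * exp (32 * \<theta> * L / real p * real k))"
  using assms(1,3)
proof (induction k)
  case 0
  have "subsets_of_card p 0 = {{}}"
    by (auto simp: subsets_of_card_def dest: finite_subset)
  moreover have "\<Phi> 0 {} \<le> real p"
  proof -
    have "posdef (diag_shift g (shift 0)) {}" by (simp add: posdef_def)
    then have "\<Phi> 0 {} \<le> pot 0 {}" by (auto simp: \<Phi>_def good_def)
    also have "\<dots> = real p" by (simp add: pot_def en_def energy_def)
    finally show ?thesis .
  qed
  ultimately show ?case by simp
next
  case (Suc k)
  define q where "q = exp (32 * \<theta> * L / real p)"
  have sh: "0 \<le> shift k" using Suc.prems \<eta>_nonneg by (simp add: shift_def algebra_simps)
  have "real (Suc k) * (\<Sum>I\<in>subsets_of_card p (Suc k). \<Phi> (Suc k) I)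
      = (\<Sum>I\<in>subsets_of_card p (Suc k). \<Sum>i\<in>I. \<Phi> (Suc k) (insert i (I - {i})))"
    unfolding sum_distrib_left
    by (intro sum.cong refl) (auto simp: subsets_of_card_def insert_absorb)
  also have "\<dots> = (\<Sum>I\<in>subsets_of_card p k. \<Sum>i\<in>{..<p} - I. \<Phi> (Suc k) (insert i I))"
    by (rule sum_add_element_eq_sum_remove_element[symmetric])
  also have "\<dots> \<le> (\<Sum>I\<in>subsets_of_card p k. real (p - k) * q * \<Phi> k I)"
    unfolding q_def using Suc.prems
    by (intro sum_mono potential_step) (auto simp: subsets_of_card_def)
  also have "\<dots> = real (p - k) * q * (\<Sum>I\<in>subsets_of_card p k. \<Phi> k I)"
    by (simp add: sum_distrib_left)
  also have "\<dots> \<le> real (p - k) * q * (real (p choose k) * (real p * exp (32 * \<theta> * L / real p * real k)))"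
    using Suc sh by (intro mult_left_mono) (auto simp: q_def)
  also have "\<dots> = (real (p - k) * real (p choose k)) * (real p * exp (32 * \<theta> * L / real p * real (Suc k)))"
    by (simp add: q_def ring_distribs exp_add)
  also have "real (p - k) * real (p choose k) = real (Suc k) * real (p choose Suc k)"
    using binomial_absorb_comp[of p k] Suc_times_binomial_eq[of p k] binomial_absorption[of k p]
    by (metis of_nat_mult)
  finally show ?case by (simp add: mult.assoc)
qed

text \<open>
  Markov's inequality: bad sets have potential exactly \<open>exp (\<theta> \<tau>)\<close>.
\<close>

lemma card_bad_le:
  assumes "2 * k \<le> p" "p > 0" "0 \<le> shift k"
  shows "real (card {I \<in> subsets_of_card p k. \<not> good k I})
    \<le> real (p choose k) * (real p * exp (32 * \<theta> * L / real p * real k - \<theta> * \<tau>))"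
proof -
  have "real (card {I \<in> subsets_of_card p k. \<not> good k I}) * exp (\<theta> * \<tau>)
      = (\<Sum>I\<in>{I \<in> subsets_of_card p k. \<not> good k I}. \<Phi> k I)"
    by (simp add: \<Phi>_def)
  also have "\<dots> \<le> (\<Sum>I\<in>subsets_of_card p k. \<Phi> k I)"
    by (rule sum_mono2) (auto simp: \<Phi>_nonneg)
  also note average_potential_le[OF assms]
  finally have "real (card {I \<in> subsets_of_card p k. \<not> good k I}) \<le>
     real (p choose k) * (real p * exp (32 * \<theta> * L / real p * real k)) / exp (\<theta> * \<tau>)"
    by (simp add: pos_le_divide_eq)
  then show ?thesis by (simp add: exp_diff)
qed

text \<open>
  The energies of a set \<open>I\<close> inform only about indices outside \<open>I\<close>.  For an index \<open>i\<close> in \<open>I\<close> the set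
  \<open>I - {i}\<close> is used instead; a random \<open>k\<close>-set with one of its elements removed is a random
  \<open>(k-1)\<close>-set, so the price is a union bound over the \<open>k\<close> elements.
\<close>

lemma card_bad_leave_one_out_le:
  assumes "k \<ge> 1" "k \<le> p"
  shows "real (card {I \<in> subsets_of_card p k. \<exists>i\<in>I. \<not> good (k - 1) (I - {i})}) * real (p choose (k - 1))
    \<le> real k * real (p choose k) * real (card {I \<in> subsets_of_card p (k - 1). \<not> good (k - 1) I})"
proof -
  obtain m where m: "k = Suc m" using assms(1) by (cases k) auto
  define b where "b I = (if good m I then 0 else 1 :: real)" for I
  define B where "B = {I \<in> subsets_of_card p k. \<exists>i\<in>I. \<not> good m (I - {i})}"
  define B' where "B' = {I \<in> subsets_of_card p m. \<not> good m I}"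
  have fin: "finite I" if "I \<in> subsets_of_card p k" for I
    using that finite_subset unfolding subsets_of_card_def by blast
  have "real (card B) = (\<Sum>I\<in>B. 1)" by simp
  also have "\<dots> \<le> (\<Sum>I\<in>B. \<Sum>i\<in>I. b (I - {i}))"
  proof (rule sum_mono)
    fix I assume I: "I \<in> B"
    then obtain i where i: "i \<in> I" "\<not> good m (I - {i})" by (auto simp: B_def)
    have "1 = b (I - {i})" using i by (simp add: b_def)
    also have "\<dots> \<le> (\<Sum>i\<in>I. b (I - {i}))"
      using i I fin by (intro member_le_sum[of i I "\<lambda>i. b (I - {i})"]) (auto simp: b_def B_def)
    finally show "1 \<le> (\<Sum>i\<in>I. b (I - {i}))" .
  qed
  also have "\<dots> \<le> (\<Sum>I\<in>subsets_of_card p (Suc m). \<Sum>i\<in>I. b (I - {i}))"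
    by (rule sum_mono2) (auto simp: B_def m b_def intro!: sum_nonneg)
  also have "\<dots> = (\<Sum>I\<in>subsets_of_card p m. \<Sum>i\<in>{..<p} - I. b I)"
    by (rule sum_add_element_eq_sum_remove_element[symmetric])
  also have "\<dots> = (\<Sum>I\<in>subsets_of_card p m. real (p - m) * b I)"
    by (intro sum.cong refl) (auto simp: subsets_of_card_def card_Diff_subset finite_subset)
  also have "\<dots> = real (p - m) * real (card B')"
    unfolding B'_def b_def
    by (simp add: sum_distrib_left[symmetric] sum.If_cases Int_def)
  finally have "real (card B) * real (p choose m) \<le> real (p - m) * real (card B') * real (p choose m)"
    by (rule mult_right_mono) simp
  also have "real (p - m) * real (card B') * real (p choose m) = (real (p - m) * real (p choose m)) * real (card B')"
    by simp
  also have "real (p - m) * real (p choose m) = real (Suc m) * real (p choose Suc m)"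
    using binomial_absorb_comp[of p m] binomial_absorption[of m p] by (metis of_nat_mult)
  finally show ?thesis by (simp add: m B_def B'_def)
qed

end

section \<open>Gram matrices of random supports\<close>

definition gram :: "nat \<Rightarrow> (nat \<Rightarrow> nat \<Rightarrow> real) \<Rightarrow> nat \<Rightarrow> nat \<Rightarrow> real" where
  "gram n X i j = inner_n n (mat_col X i) (mat_col X j)"

lemma symm_gram: "symm (gram n X)"
  by (simp add: symm_def gram_def inner_n_def mult.commute)

lemma norm2_sq: "(norm2 n v)\<^sup>2 = inner_n n v v"
  by (simp add: L2_set_def inner_n_def sum_nonneg power2_eq_square)

lemma gram_diag: "norm2 n (mat_col X j) = 1 \<Longrightarrow> gram n X j j = 1"
  using norm2_sq[of "mat_col X j" n] by (simp add: gram_def)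

lemma gram_row: "(\<Sum>l\<in>I. gram n X i l * x l) = inner_n n (mat_col X i) (\<lambda>k. \<Sum>l\<in>I. X k l * x l)"
  unfolding gram_def inner_n_def mat_col_def
  by (simp add: sum_distrib_left sum_distrib_right mult.assoc sum.swap[of _ I])

lemma qform_gram: "qform (gram n X) I x = (\<Sum>k<n. (\<Sum>l\<in>I. X k l * x l)\<^sup>2)"
proof -
  have "qform (gram n X) I x = (\<Sum>i\<in>I. \<Sum>k<n. X k i * x i * (\<Sum>l\<in>I. X k l * x l))"
    unfolding qform_eq_sum_rows gram_row inner_n_def mat_col_def sum_distrib_right
    by (intro sum.cong refl) (simp add: mult_ac)
  also have "\<dots> = (\<Sum>k<n. \<Sum>i\<in>I. X k i * x i * (\<Sum>l\<in>I. X k l * x l))" by (rule sum.swap)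
  finally show ?thesis by (simp add: power2_eq_square flip: sum_distrib_right)
qed

lemma mat_vec_norm_bound: "norm2 n (mat_vec p X v) \<le> (\<Sum>i<n. \<Sum>j<p. \<bar>X i j\<bar>) * norm2 p v"
proof -
  have "norm2 n (mat_vec p X v) \<le> (\<Sum>i<n. \<bar>mat_vec p X v i\<bar>)" by (rule L2_set_le_sum_abs)
  also have "\<dots> \<le> (\<Sum>i<n. \<Sum>j<p. \<bar>X i j\<bar> * norm2 p v)"
  proof (rule sum_mono)
    fix i
    have "\<bar>mat_vec p X v i\<bar> \<le> (\<Sum>j<p. \<bar>X i j * v j\<bar>)" unfolding mat_vec_def by (rule sum_abs)
    also have "\<dots> \<le> (\<Sum>j<p. \<bar>X i j\<bar> * norm2 p v)"
    proof (rule sum_mono)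
      fix j assume "j \<in> {..<p}"
      then have "\<bar>v j\<bar> \<le> norm2 p (\<lambda>j. \<bar>v j\<bar>)"
        by (intro member_le_L2_set[of _ _ "\<lambda>j. \<bar>v j\<bar>"]) auto
      then have "\<bar>v j\<bar> \<le> norm2 p v" by (simp add: L2_set_def)
      then show "\<bar>X i j * v j\<bar> \<le> \<bar>X i j\<bar> * norm2 p v"
        by (simp add: abs_mult mult_left_mono)
    qed
    finally show "\<bar>mat_vec p X v i\<bar> \<le> (\<Sum>j<p. \<bar>X i j\<bar> * norm2 p v)" .
  qed
  finally show ?thesis by (simp add: sum_distrib_right)
qed

lemma mat_vec_le_op_norm: "norm2 n (mat_vec p X v) \<le> op_norm n p X * norm2 p v"
proof -
  define u where "u = restrict v {..<p}"
  have u: "u \<in> Rvec p" by (simp add: u_def Rvec_def)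
  have same: "mat_vec p X u = mat_vec p X v" "norm2 p u = norm2 p v"
    by (auto simp: u_def mat_vec_def L2_set_def)
  have bdd: "bdd_above ((\<lambda>v. norm2 n (mat_vec p X v) / norm2 p v) ` Rvec p)"
  proof (rule bdd_aboveI2)
    fix v
    show "norm2 n (mat_vec p X v) / norm2 p v \<le> (\<Sum>i<n. \<Sum>j<p. \<bar>X i j\<bar>)"
      using mat_vec_norm_bound[of p X v n]
      by (cases "norm2 p v = 0") (auto simp: sum_nonneg divide_le_eq less_le)
  qed
  have le: "norm2 n (mat_vec p X v) / norm2 p v \<le> op_norm n p X"
    unfolding op_norm_def using cSUP_upper[OF u bdd] by (simp add: same)
  show ?thesis
  proof (cases "norm2 p v = 0")
    case True
    then show ?thesis using mat_vec_norm_bound[of p X v n] by simp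
  next
    case False
    then show ?thesis using le by (simp add: pos_divide_le_eq less_le)
  qed
qed

lemma op_norm_ge_1:
  assumes "j < p" "norm2 n (mat_col X j) = 1"
  shows "op_norm n p X \<ge> 1"
proof -
  define e where "e l = (if l = j then 1 else 0 :: real)" for l
  have "mat_vec p X e = mat_col X j"
    using assms by (auto simp: mat_vec_def mat_col_def e_def fun_eq_iff if_distrib cong: if_cong)
  moreover have "norm2 p e = 1"
  proof -
    have "(\<Sum>l<p. (e l)\<^sup>2) = (\<Sum>l<p. if l = j then 1 else 0)"
      by (intro sum.cong refl) (simp add: e_def)
    then show ?thesis using assms(1) by (simp add: L2_set_def)
  qed
  ultimately show ?thesis using mat_vec_le_op_norm[of p X e n] assms(2) by simp
qed

text \<open>
  The inequality \<open>(X\<^sup>T X)\<^sup>2 \<le> \<parallel>X\<parallel>\<^sup>2 X\<^sup>T X\<close>, that is \<open>\<bar>X\<^sup>T u\<bar> \<le> \<parallel>X\<parallel> \<bar>u\<bar>\<close> for \<open>u = X x\<close>: with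
  \<open>v = X\<^sup>T u\<close> one has \<open>\<bar>v\<bar>\<^sup>2 = \<langle>u, X v\<rangle> \<le> \<bar>u\<bar> \<parallel>X\<parallel> \<bar>v\<bar>\<close>.
\<close>

lemma gram_square_le:
  "(\<Sum>i<p. (\<Sum>l<p. gram n X i l * x l)\<^sup>2) \<le> (op_norm n p X)\<^sup>2 * qform (gram n X) {..<p} x"
proof -
  define u where "u = mat_vec p X x"
  define v where "v i = inner_n n (mat_col X i) u" for i
  have v: "(\<Sum>l<p. gram n X i l * x l) = v i" for i
    by (simp add: gram_row v_def u_def mat_vec_def)
  have "(norm2 p v)\<^sup>2 = (\<Sum>i<p. \<Sum>k<n. X k i * u k * v i)"
    by (simp add: norm2_sq inner_n_def v_def mat_col_def sum_distrib_right sum_distrib_left mult_ac)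
  also have "\<dots> = (\<Sum>k<n. \<Sum>i<p. X k i * u k * v i)" by (rule sum.swap)
  also have "\<dots> = (\<Sum>k<n. u k * mat_vec p X v k)"
    by (simp add: mat_vec_def sum_distrib_left mult_ac)
  also have "\<dots> \<le> (\<Sum>k<n. \<bar>u k\<bar> * \<bar>mat_vec p X v k\<bar>)"
    by (intro sum_mono) (metis abs_ge_self abs_mult)
  also have "\<dots> \<le> norm2 n u * norm2 n (mat_vec p X v)" by (rule L2_set_mult_ineq)
  also have "\<dots> \<le> norm2 n u * (op_norm n p X * norm2 p v)"
    by (intro mult_left_mono mat_vec_le_op_norm) auto
  finally have *: "norm2 p v * norm2 p v \<le> (norm2 n u * op_norm n p X) * norm2 p v"
    by (simp add: power2_eq_square mult_ac)
  have "norm2 p v \<le> norm2 n u * op_norm n p X"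
  proof (cases "norm2 p v = 0")
    case True
    have "norm2 n u \<ge> 0" by simp
    moreover have "op_norm n p X \<ge> 0 \<or> norm2 n u = 0"
      using mat_vec_le_op_norm[of p X x n] mult_neg_pos[of "op_norm n p X" "norm2 p x"]
        L2_set_nonneg[of x "{..<p}"] L2_set_nonneg[of u "{..<n}"] unfolding u_def
      by (smt (verit) mult_nonneg_nonneg mult_nonpos_nonneg)
    ultimately show ?thesis using True by auto
  next
    case False
    then have "norm2 p v > 0" by (simp add: less_le)
    then show ?thesis using * by simp
  qed
  then have "(norm2 p v)\<^sup>2 \<le> (norm2 n u * op_norm n p X)\<^sup>2"
    by (intro power_mono) auto
  also have "(norm2 n u)\<^sup>2 = qform (gram n X) {..<p} x"
    unfolding qform_gram norm2_sq u_def by (simp add: inner_n_def mat_vec_def power2_eq_square)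
  then have "(norm2 n u * op_norm n p X)\<^sup>2 = (op_norm n p X)\<^sup>2 * qform (gram n X) {..<p} x"
    by (simp add: power_mult_distrib)
  finally show ?thesis unfolding norm2_sq inner_n_def by (simp add: v power2_eq_square)
qed

lemma gram_le_coherence:
  assumes "i < p" "j < p" "i \<noteq> j"
  shows "\<bar>gram n X i j\<bar> \<le> coherence n p X"
proof -
  have fin: "finite {(i, j). i < j \<and> j < p}"
    by (rule finite_subset[of _ "{..<p} \<times> {..<p}"]) auto
  have *: "\<bar>gram n X a b\<bar> \<le> coherence n p X" if "a < b" "b < p" for a b
  proof -
    have "(case (a, b) of (i, j) \<Rightarrow> \<bar>inner_n n (mat_col X i) (mat_col X j)\<bar>) \<le> coherence n p X"
      unfolding coherence_def
      by (rule cSUP_upper) (use that fin in auto)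
    then show ?thesis by (simp add: gram_def)
  qed
  show ?thesis
    using *[of i j] *[of j i] assms symm_gram[of n X] unfolding symm_def
    by (metis linorder_neqE_nat)
qed

text \<open>
  For a Gram matrix, the solution is the vector of coefficients of the projection of column \<open>j\<close>
  onto the other columns in \<open>I\<close>, and the energy is the squared length of this projection.
\<close>

definition well_conditioned :: "(nat \<Rightarrow> nat \<Rightarrow> real) \<Rightarrow> nat \<Rightarrow> real \<Rightarrow> nat set \<Rightarrow> bool" where
  "well_conditioned g p \<delta> I \<longleftrightarrow> posdef g I \<and>
     (\<forall>j<p. (\<Sum>l\<in>I - {j}. (solution g (I - {j}) (\<lambda>l. g l j) l)\<^sup>2) \<le> \<delta> \<and>
        energy g (I - {j}) (\<lambda>l. g l j) \<le> 1 / 8)"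

context barrier
begin

lemma good_posdef:
  assumes "good k I" "I \<subseteq> {..<p}" "shift k \<ge> 0"
  shows "posdef g I"
proof -
  have "posdef (diag_shift g 0) I"
    by (rule posdef_diag_shift_mono[of _ _ "shift k"]) (use assms finite_subset in \<open>auto simp: good_def\<close>)
  then show ?thesis by (simp add: diag_shift_def)
qed

text \<open>
  The energy bound holds for the shifted matrix, and it is needed for the matrix itself.  Insert
  the multiples \<open>c w\<close> of the unshifted solution into the variational problem of the shifted matrix:
  \<open>c = 1\<close> bounds the energy, and \<open>c = 2\<close> cancels the energy and bounds \<open>4 s \<bar>w\<bar>\<^sup>2\<close>.
\<close>

lemma good_solution:
  assumes good: "good k I" and I: "I \<subseteq> {..<p}" and j: "j < p" "j \<notin> I" and sh: "shift k \<ge> 1 / 2"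
  shows "(\<Sum>l\<in>I. (solution g I (\<lambda>l. g l j) l)\<^sup>2) \<le> \<tau> / 2 \<and> energy g I (\<lambda>l. g l j) \<le> 1 / 8"
proof -
  have fin: "finite I" using I finite_subset by blast
  define s where "s = shift k"
  define w where "w = solution g I (\<lambda>l. g l j)"
  have pdg: "posdef g I" by (rule good_posdef[OF good I]) (use sh in simp)
  have pd: "posdef (diag_shift g s) I" using good by (simp add: good_def s_def)
  have w: "solves g I (\<lambda>l. g l j) w" unfolding w_def by (rule solves_solution[OF fin symm_g pdg])
  define e where "e = (\<Sum>l\<in>I. g l j * w l)"
  define W where "W = (\<Sum>l\<in>I. (w l)\<^sup>2)"
  have W: "W \<ge> 0" by (simp add: W_def sum_nonneg)
  have en: "energy (diag_shift g s) I (\<lambda>l. g l j) \<le> \<tau>"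
    using good_en_le[OF good j] by (simp add: en_def s_def)
  have scaled: "2 * (c * e) - c\<^sup>2 * (e - s * W) \<le> \<tau>" for c
  proof -
    have "2 * (\<Sum>l\<in>I. g l j * (c * w l)) - qform (diag_shift g s) I (\<lambda>l. c * w l) \<le> \<tau>"
      using energy_variational[OF fin symm_diag_shift[OF symm_g] pd, of "\<lambda>l. g l j" "\<lambda>l. c * w l"] en
      by simp
    also have "(\<Sum>l\<in>I. g l j * (c * w l)) = c * e"
      by (simp add: e_def sum_distrib_left mult_ac)
    also have "qform (diag_shift g s) I (\<lambda>l. c * w l) = c\<^sup>2 * qform (diag_shift g s) I w"
      by (simp add: qform_def sum_distrib_left power2_eq_square mult_ac)
    also have "qform (diag_shift g s) I w = e - s * W"
      by (simp add: qform_diag_shift[OF fin] qform_solves[OF w] e_def W_def)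
    finally show ?thesis .
  qed
  have "1 / 2 * W \<le> s * W" using sh W by (intro mult_right_mono) (auto simp: s_def)
  moreover have "0 \<le> s * W" using sh W by (simp add: s_def)
  ultimately have "e \<le> \<tau>" "2 * W \<le> \<tau>" using scaled[of 1] scaled[of 2] by auto
  then show ?thesis using \<tau>_le by (simp add: e_def W_def w_def energy_def)
qed

lemma good_imp_well_conditioned:
  assumes I: "I \<subseteq> {..<p}" and good: "good k I" "\<And>i. i \<in> I \<Longrightarrow> good (k - 1) (I - {i})"
    and sh: "shift k \<ge> 1 / 2"
  shows "well_conditioned g p (\<tau> / 2) I"
  unfolding well_conditioned_def
proof (intro conjI allI impI)
  show "posdef g I" by (rule good_posdef[OF good(1) I]) (use sh in simp)
  fix j assume j: "j < p"
  have "shift k \<le> shift (k - 1)"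
    using \<eta>_nonneg unfolding shift_def by (simp add: mult_right_mono)
  then have sh': "shift (k - 1) \<ge> 1 / 2" using sh by simp
  have "(\<Sum>l\<in>I - {j}. (solution g (I - {j}) (\<lambda>l. g l j) l)\<^sup>2) \<le> \<tau> / 2
      \<and> energy g (I - {j}) (\<lambda>l. g l j) \<le> 1 / 8"
  proof (cases "j \<in> I")
    case True
    show ?thesis by (rule good_solution[OF good(2)[OF True] _ j _ sh']) (use I in auto)
  next
    case False
    then show ?thesis using good_solution[OF good(1) I j False sh] by simp
  qed
  then show "(\<Sum>l\<in>I - {j}. (solution g (I - {j}) (\<lambda>l. g l j) l)\<^sup>2) \<le> \<tau> / 2"
    "energy g (I - {j}) (\<lambda>l. g l j) \<le> 1 / 8" by auto
qed

end

text \<open>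
  The parameters of the barrier.  With \<open>l = log p\<close> and \<open>a = 1/320\<close> take \<open>\<tau> = a / l\<close>, the same order as the
  coherence, and the largest \<open>\<theta>\<close> that keeps increments small, \<open>\<theta> = l\<^sup>2 / (32 a\<^sup>2) = 3200 l\<^sup>2\<close>.  Then
  \<open>\<theta> \<tau> = 10 l\<close>, so a failure costs \<open>p\<^sup>1\<^sup>0\<close>, whereas the bound \<open>S L \<le> a\<^sup>2 p / l\<close> limits the growth of the
  potential over \<open>S\<close> steps to \<open>exp l = p\<close>; with the initial value \<open>p\<close> this leaves \<open>p\<^sup>-\<^sup>8\<close>.
  Removing each single element of the support costs a further factor at most \<open>1 + S \<le> p\<^sup>2\<close>.
\<close>

lemma most_supports_well_conditioned:
  assumes p: "p \<ge> 2" and X: "\<And>j. j < p \<Longrightarrow> norm2 n (mat_col X j) = 1"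
    and coh: "coherence n p X \<le> (1 / 320) / ln (real p)"
    and S: "S \<ge> 1" "real S \<le> (1 / 320)\<^sup>2 * real p / ((op_norm n p X)\<^sup>2 * ln (real p))"
  shows "real (card {I \<in> subsets_of_card p S. \<not> well_conditioned (gram n X) p (1 / (640 * ln (real p))) I})
     \<le> real p powr (- 6) * real (p choose S)"
proof -
  define L where "L = (op_norm n p X)\<^sup>2"
  define l where "l = ln (real p)"
  define \<tau> where "\<tau> = (1 / 320) / l"
  define \<theta> where "\<theta> = 3200 * l\<^sup>2"
  have l: "l \<ge> 2 / 3"
  proof -
    have "ln 2 \<le> l" unfolding l_def using p by (subst ln_le_cancel_iff) auto
    then show ?thesis using ln2_ge_two_thirds by simp
  qed
  have L: "L \<ge> 1" unfolding L_def using op_norm_ge_1[of 0 p X n] X p by (simp add: one_le_power)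
  have SL: "real S * L * l \<le> (1 / 320)\<^sup>2 * real p"
    using S(2) l L by (simp add: L_def[symmetric] l_def[symmetric] pos_le_divide_eq mult_ac)
  interpret barrier "gram n X" p L "\<tau>" \<theta> \<tau>
  proof
    show "symm (gram n X)" by (rule symm_gram)
    show "gram n X i i = 1" if "i < p" for i using X[OF that] by (rule gram_diag)
    show "\<bar>gram n X i j\<bar> \<le> \<tau>" if "i < p" "j < p" "i \<noteq> j" for i j
      using gram_le_coherence[OF that, of n X] coh by (simp add: \<tau>_def l_def)
    show "(\<Sum>i<p. (\<Sum>l<p. gram n X i l * x l)\<^sup>2) \<le> L * qform (gram n X) {..<p} x" for x
      unfolding L_def by (rule gram_square_le)
    show "0 \<le> L" using L by simp
    show "0 < \<theta>" using l by (simp add: \<theta>_def)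
    show "\<tau> \<le> 1 / 8" using l by (simp add: \<tau>_def field_simps)
    show "8 * \<theta> * (\<tau> + \<tau>)\<^sup>2 \<le> 1" using l by (simp add: \<theta>_def \<tau>_def power2_eq_square)
  qed
  have Sp: "2 * S \<le> p"
  proof -
    have "real S * (2 / 3) \<le> real S * (L * l)"
      using l L mult_mono[of 1 L "2/3" l] by (intro mult_left_mono) auto
    then have "2 * real S \<le> real p" using SL by (simp add: power2_eq_square mult.assoc)
    then show ?thesis by linarith
  qed
  have S\<eta>: "real S * \<eta> \<le> 1 / 4"
  proof -
    have "real S * L * (2 / 3) \<le> real S * L * l" using l L by (intro mult_left_mono) auto
    then have "32 * (real S * L) \<le> real p / 4" using SL by (simp add: power2_eq_square)
    then show ?thesis using p by (simp add: \<eta>_def field_simps)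
  qed
  have sh: "shift k \<ge> 1 / 2" if "k \<le> S" for k
  proof -
    have "real k * \<eta> \<le> real S * \<eta>" using that \<eta>_nonneg by (intro mult_right_mono) auto
    then show ?thesis using S\<eta> by (simp add: shift_def)
  qed
  define \<epsilon> where "\<epsilon> = exp (- 8 * l)"
  have rate: "real p * exp (32 * \<theta> * L / real p * real k - \<theta> * \<tau>) \<le> \<epsilon>" if k: "k \<le> S" for k
  proof -
    have "32 * \<theta> * L / real p * real k = 102400 * l * (real k * L * l) / real p"
      by (simp add: \<theta>_def power2_eq_square)
    also have "\<dots> \<le> 102400 * l * (real S * L * l) / real p"
      using k l L by (intro divide_right_mono mult_left_mono mult_right_mono) auto
    also have "\<dots> \<le> 102400 * l * ((1 / 320)\<^sup>2 * real p) / real p"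
      using SL l by (intro divide_right_mono mult_left_mono) auto
    also have "\<dots> = l" using p by (simp add: power2_eq_square)
    finally have "32 * \<theta> * L / real p * real k - \<theta> * \<tau> \<le> l - 10 * l"
      using l by (simp add: \<theta>_def \<tau>_def power2_eq_square)
    then have "exp (32 * \<theta> * L / real p * real k - \<theta> * \<tau>) \<le> exp (- 9 * l)" by simp
    then have "real p * exp (32 * \<theta> * L / real p * real k - \<theta> * \<tau>) \<le> real p * exp (- 9 * l)"
      by (rule mult_left_mono) simp
    also have "\<dots> = exp l * exp (- 9 * l)" using p by (simp add: l_def)
    also have "\<dots> = \<epsilon>" by (simp add: \<epsilon>_def flip: exp_add)
    finally show ?thesis .
  qed
  define B where "B k = {I \<in> subsets_of_card p k. \<not> good k I}" for k
  define B' where "B' = {I \<in> subsets_of_card p S. \<exists>i\<in>I. \<not> good (S - 1) (I - {i})}"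
  have bad: "real (card (B k)) \<le> real (p choose k) * \<epsilon>" if "k \<le> S" for k
  proof -
    have "real (card (B k)) \<le> real (p choose k) * (real p * exp (32 * \<theta> * L / real p * real k - \<theta> * \<tau>))"
      unfolding B_def by (rule card_bad_le) (use that Sp p sh[OF that] in auto)
    also have "\<dots> \<le> real (p choose k) * \<epsilon>" using rate[OF that] by (intro mult_left_mono) auto
    finally show ?thesis .
  qed
  have bad': "real (card B') \<le> real S * real (p choose S) * \<epsilon>"
  proof -
    have "real (card B') * real (p choose (S - 1)) \<le> real S * real (p choose S) * real (card (B (S - 1)))"
      unfolding B'_def B_def using S(1) Sp by (intro card_bad_leave_one_out_le) auto
    also have "\<dots> \<le> real S * real (p choose S) * (real (p choose (S - 1)) * \<epsilon>)"
      by (intro mult_left_mono bad) auto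
    finally have "real (card B') * real (p choose (S - 1)) \<le> real S * real (p choose S) * \<epsilon> * real (p choose (S - 1))"
      by (simp add: mult_ac)
    moreover have "real (p choose (S - 1)) > 0" using Sp by (simp add: zero_less_binomial)
    ultimately show ?thesis by simp
  qed
  have "{I \<in> subsets_of_card p S. \<not> well_conditioned (gram n X) p (1 / (640 * ln (real p))) I} \<subseteq> B S \<union> B'"
  proof
    fix I assume I: "I \<in> {I \<in> subsets_of_card p S. \<not> well_conditioned (gram n X) p (1 / (640 * ln (real p))) I}"
    have "\<tau> / 2 = 1 / (640 * ln (real p))" by (simp add: \<tau>_def l_def)
    then show "I \<in> B S \<union> B'"
      using good_imp_well_conditioned[of I S] I sh[of S]
      unfolding B_def B'_def subsets_of_card_def by auto
  qed
  then have "card {I \<in> subsets_of_card p S. \<not> well_conditioned (gram n X) p (1 / (640 * ln (real p))) I} \<le> card (B S \<union> B')"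
    by (intro card_mono) (auto simp: B_def B'_def)
  also have "\<dots> \<le> card (B S) + card B'" by (rule card_Un_le)
  finally have "real (card {I \<in> subsets_of_card p S. \<not> well_conditioned (gram n X) p (1 / (640 * ln (real p))) I})
      \<le> real (card (B S)) + real (card B')" by linarith
  also have "\<dots> \<le> (1 + real S) * \<epsilon> * real (p choose S)"
    using bad[of S] bad' by (simp add: algebra_simps)
  also have "\<dots> \<le> real p powr (- 6) * real (p choose S)"
  proof (rule mult_right_mono)
    have "1 + real S \<le> real p * 2" using Sp p by linarith
    also have "\<dots> \<le> real p * real p" using p by (intro mult_left_mono) auto
    also have "\<dots> = exp l * exp l" using p by (simp add: l_def)
    also have "\<dots> = exp (2 * l)" unfolding mult_2 exp_add ..
    finally have "(1 + real S) * \<epsilon> \<le> exp (2 * l) * \<epsilon>" by (rule mult_right_mono) (simp add: \<epsilon>_def)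
    also have "\<dots> = exp (- 6 * l)" by (simp add: \<epsilon>_def flip: exp_add)
    also have "\<dots> = real p powr (- 6)" using p by (simp add: l_def powr_def)
    finally show "(1 + real S) * \<epsilon> \<le> real p powr (- 6)" .
  qed simp
  finally show ?thesis .
qed

section \<open>Deterministic sign recovery\<close>

text \<open>
  The certificate for a unique minimiser.  Moving from \<open>c\<close> to \<open>b\<close> changes the objective by
  \<open>\<bar>X (b - c)\<bar>\<^sup>2 / 2\<close> plus a sum of terms \<open>T l\<close>, one for each coordinate, that are nonnegative because the
  residual correlations form a subgradient of the penalty.  If \<open>b\<close> is a minimiser, everything
  vanishes: strictness puts the support of \<open>b\<close> inside \<open>I\<close>, and definiteness then gives \<open>b = c\<close>.
\<close>

lemma lasso_estimate_unique:
  assumes t: "lam * \<sigma> > 0" and I: "I \<subseteq> {..<p}" and pd: "posdef (gram n X) I"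
    and c: "c \<in> Rvec p" "\<And>j. j < p \<Longrightarrow> j \<notin> I \<Longrightarrow> c j = 0"
    and active: "\<And>i. i \<in> I \<Longrightarrow> inner_n n (mat_col X i) (\<lambda>k. y k - mat_vec p X c k) = lam * \<sigma> * sgn (c i)"
    and inactive: "\<And>j. j < p \<Longrightarrow> j \<notin> I \<Longrightarrow>
       \<bar>inner_n n (mat_col X j) (\<lambda>k. y k - mat_vec p X c k)\<bar> < lam * \<sigma>"
    and b: "lasso_estimate n p X y lam \<sigma> b" and j: "j < p"
  shows "b j = c j"
proof -
  define \<rho> where "\<rho> k = y k - mat_vec p X c k" for k
  define a where "a i = inner_n n (mat_col X i) \<rho>" for i
  define h where "h l = b l - c l" for l
  define T where "T l = lam * \<sigma> * \<bar>b l\<bar> - lam * \<sigma> * \<bar>c l\<bar> - h l * a l" for l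
  have \<rho>h: "y k - mat_vec p X b k = \<rho> k - mat_vec p X h k" for k
    by (simp add: \<rho>_def h_def mat_vec_def right_diff_distrib sum_subtractf)
  have pair: "inner_n n \<rho> (mat_vec p X h) = (\<Sum>l<p. h l * a l)"
  proof -
    have "inner_n n \<rho> (mat_vec p X h) = (\<Sum>k<n. \<Sum>l<p. h l * (X k l * \<rho> k))"
      unfolding inner_n_def mat_vec_def sum_distrib_left by (intro sum.cong refl) (simp add: mult_ac)
    also have "\<dots> = (\<Sum>l<p. \<Sum>k<n. h l * (X k l * \<rho> k))" by (rule sum.swap)
    finally show ?thesis by (simp add: a_def inner_n_def mat_col_def sum_distrib_left)
  qed
  have T_eq: "(\<Sum>l<p. T l) = lam * \<sigma> * (\<Sum>l<p. \<bar>b l\<bar>) - lam * \<sigma> * (\<Sum>l<p. \<bar>c l\<bar>) - (\<Sum>l<p. h l * a l)"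
    by (simp add: T_def sum_subtractf sum_distrib_left)
  have "(norm2 n (\<lambda>k. y k - mat_vec p X b k))\<^sup>2
      = (norm2 n \<rho>)\<^sup>2 - 2 * inner_n n \<rho> (mat_vec p X h) + (norm2 n (mat_vec p X h))\<^sup>2"
    unfolding norm2_sq inner_n_def \<rho>h
    by (simp add: algebra_simps sum.distrib sum_subtractf sum_distrib_left)
  moreover have "lasso_objective n p X y lam \<sigma> b \<le> lasso_objective n p X y lam \<sigma> c"
    using b c(1) unfolding lasso_estimate_def is_arg_min_def by (auto simp: not_less)
  moreover have "(norm2 n (\<lambda>k. y k - mat_vec p X c k))\<^sup>2 = (norm2 n \<rho>)\<^sup>2"
    by (simp add: \<rho>_def[abs_def])
  ultimately have main: "1 / 2 * (norm2 n (mat_vec p X h))\<^sup>2 + (\<Sum>l<p. T l) \<le> 0"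
    unfolding lasso_objective_def pair norm1_def T_eq by linarith
  have T: "T l \<ge> 0" "l \<notin> I \<Longrightarrow> T l = 0 \<Longrightarrow> b l = 0" if l: "l < p" for l
  proof -
    have "T l \<ge> 0 \<and> (l \<notin> I \<longrightarrow> T l = 0 \<longrightarrow> b l = 0)"
    proof (cases "l \<in> I")
      case True
      have "T l = lam * \<sigma> * (\<bar>b l\<bar> - sgn (c l) * b l)"
        using active[OF True] unfolding T_def h_def a_def \<rho>_def[abs_def]
        by (simp add: algebra_simps abs_sgn)
      moreover have "sgn (c l) * b l \<le> \<bar>b l\<bar>" by (auto simp: sgn_if)
      ultimately show ?thesis using t True by simp
    next
      case False
      have al: "\<bar>a l\<bar> < lam * \<sigma>" using inactive[OF l False] by (simp add: a_def \<rho>_def[abs_def])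
      have "b l * a l \<le> \<bar>b l\<bar> * \<bar>a l\<bar>" by (metis abs_ge_self abs_mult)
      then have "T l \<ge> (lam * \<sigma> - \<bar>a l\<bar>) * \<bar>b l\<bar>"
        using c(2)[OF l False] by (simp add: T_def h_def algebra_simps)
      moreover have "(lam * \<sigma> - \<bar>a l\<bar>) * \<bar>b l\<bar> \<ge> 0" using al by simp
      moreover have "(lam * \<sigma> - \<bar>a l\<bar>) * \<bar>b l\<bar> > 0" if "b l \<noteq> 0" using al that by simp
      ultimately show ?thesis by force
    qed
    then show "T l \<ge> 0" "l \<notin> I \<Longrightarrow> T l = 0 \<Longrightarrow> b l = 0" by auto
  qed
  have Tsum: "(\<Sum>l<p. T l) \<ge> 0" using T(1) by (intro sum_nonneg) auto
  have Xh: "(norm2 n (mat_vec p X h))\<^sup>2 \<le> 0" and "(\<Sum>l<p. T l) \<le> 0"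
    using main Tsum zero_le_power2[of "norm2 n (mat_vec p X h)"] by linarith+
  then have "(\<Sum>l<p. T l) = 0" using Tsum by simp
  then have T0: "T l = 0" if "l < p" for l
    using T(1) that by (subst (asm) sum_nonneg_eq_0_iff) auto
  have off: "h l = 0" if "l < p" "l \<notin> I" for l
    using T(2)[OF that(1,2) T0[OF that(1)]] c(2)[OF that] by (simp add: h_def)
  have "qform (gram n X) I h = (\<Sum>k<n. (mat_vec p X h k)\<^sup>2)"
    unfolding qform_gram mat_vec_def
    by (intro sum.cong refl arg_cong[where f = "\<lambda>x. x\<^sup>2"] sum.mono_neutral_left) (use I off in auto)
  also have "\<dots> \<le> 0" using Xh unfolding norm2_sq inner_n_def by (simp add: power2_eq_square)
  finally have "\<not> (\<exists>i\<in>I. h i \<noteq> 0)" using pd unfolding posdef_def by force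
  then show ?thesis using off[OF j] by (auto simp: h_def)
qed

text \<open>
  When \<open>w j\<close> solves the normal equations, this is the component of column \<open>j\<close> orthogonal to the
  columns in \<open>I - {j}\<close>.
\<close>

definition proj_resid :: "(nat \<Rightarrow> nat \<Rightarrow> real) \<Rightarrow> nat set \<Rightarrow> (nat \<Rightarrow> nat \<Rightarrow> real) \<Rightarrow> nat \<Rightarrow> nat \<Rightarrow> real" where
  "proj_resid X I w j = (\<lambda>k. X k j - (\<Sum>l\<in>I - {j}. X k l * w j l))"

lemma inner_proj_resid:
  "inner_n n (proj_resid X I w j) z
     = inner_n n (mat_col X j) z - (\<Sum>l\<in>I - {j}. w j l * inner_n n (mat_col X l) z)"
proof -
  have "(\<Sum>k<n. (\<Sum>l\<in>I - {j}. X k l * w j l) * z k) = (\<Sum>k<n. \<Sum>l\<in>I - {j}. w j l * (X k l * z k))"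
    unfolding sum_distrib_right by (intro sum.cong refl) (simp add: mult_ac)
  also have "\<dots> = (\<Sum>l\<in>I - {j}. \<Sum>k<n. w j l * (X k l * z k))" by (rule sum.swap)
  finally show ?thesis
    by (simp add: inner_n_def proj_resid_def mat_col_def left_diff_distrib sum_subtractf sum_distrib_left)
qed

lemma proj_resid_norm_le:
  assumes X: "norm2 n (mat_col X j) = 1" and w: "solves (gram n X) (I - {j}) (\<lambda>l. gram n X l j) (w j)"
  shows "inner_n n (proj_resid X I w j) (proj_resid X I w j) \<le> 1"
proof -
  define g where "g = gram n X"
  define J where "J = I - {j}"
  have inner: "inner_n n (mat_col X i) (proj_resid X I w j) = g i j - (\<Sum>l\<in>J. g i l * w j l)" for i
    unfolding g_def gram_row proj_resid_def J_def
    by (simp add: gram_def inner_n_def mat_col_def right_diff_distrib sum_subtractf)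
  have "(\<Sum>l\<in>J. w j l * inner_n n (mat_col X l) (proj_resid X I w j)) = 0"
    unfolding inner using w by (intro sum.neutral) (auto simp: solves_def g_def J_def)
  then have "inner_n n (proj_resid X I w j) (proj_resid X I w j) = g j j - (\<Sum>l\<in>J. g j l * w j l)"
    by (simp add: inner_proj_resid inner J_def)
  also have "(\<Sum>l\<in>J. g j l * w j l) = qform g J (w j)"
    using symm_gram[of n X] qform_solves[OF w] unfolding symm_def g_def J_def by simp
  finally have "inner_n n (proj_resid X I w j) (proj_resid X I w j) = 1 - qform g J (w j)"
    using X by (simp add: g_def gram_diag)
  moreover have "qform g J (w j) \<ge> 0" unfolding g_def qform_gram by (simp add: sum_nonneg)
  ultimately show ?thesis by simp
qed

text \<open>
  The guess is \<open>s = \<beta> + v\<close> on \<open>I\<close>, where \<open>v\<close> solves the stationarity equations \<open>G\<^sub>I v = c\<close> with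
  \<open>c = X\<^sup>T z - t sgn \<beta>\<close> and \<open>t = \<lambda>\<sigma>\<close>.  Symmetry of the inverse moves it from \<open>c\<close> to the columns: outside \<open>I\<close>
  the residual correlation becomes \<open>\<langle>u\<^sub>j, z\<rangle> + t \<langle>w\<^sub>j, sgn \<beta>\<rangle>\<close>, at most \<open>(8/5 + 1/4) \<sigma> r < 2 \<sigma> r = t\<close>.
  For \<open>i\<close> in \<open>I\<close>, eliminating the other coordinates gives
  \<open>(1 - E\<^sub>i) v\<^sub>i = \<langle>u\<^sub>i, z\<rangle> - t (sgn \<beta>\<^sub>i - \<langle>w\<^sub>i, sgn \<beta>\<rangle>)\<close> with \<open>E\<^sub>i \<le> 1/8\<close>; so \<open>\<bar>v\<^sub>i\<bar>\<close> stays below \<open>8 \<sigma> r\<close>, hence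
  below \<open>\<bar>\<beta>\<^sub>i\<bar>\<close>, and no sign changes.
\<close>

lemma lasso_sign_recovery:
  assumes \<sigma>: "\<sigma> > 0" and r: "r > 0" and X: "\<And>j. j < p \<Longrightarrow> norm2 n (mat_col X j) = 1"
    and I: "supp p \<beta> = I" and pd: "posdef (gram n X) I"
    and w: "\<And>j. j < p \<Longrightarrow> solves (gram n X) (I - {j}) (\<lambda>l. gram n X l j) (w j)"
    and e: "\<And>j. j < p \<Longrightarrow> (\<Sum>l\<in>I - {j}. gram n X l j * w j l) \<le> 1 / 8"
    and signs: "\<And>j. j < p \<Longrightarrow> \<bar>\<Sum>l\<in>I - {j}. w j l * sgn (\<beta> l)\<bar> \<le> 1 / 8"
    and noise: "\<And>j. j < p \<Longrightarrow> \<bar>inner_n n (proj_resid X I w j) z\<bar> \<le> 8 / 5 * (\<sigma> * r)"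
    and ampl: "\<And>i. i \<in> I \<Longrightarrow> \<bar>\<beta> i\<bar> > 8 * (\<sigma> * r)"
    and b: "lasso_estimate n p X (\<lambda>i. mat_vec p X \<beta> i + z i) (2 * r) \<sigma> b"
  shows "supp p b = supp p \<beta> \<and> (\<forall>i\<in>supp p \<beta>. sgn (b i) = sgn (\<beta> i))"
proof -
  define g where "g = gram n X"
  define t where "t = 2 * (\<sigma> * r)"
  define \<zeta> where "\<zeta> i = inner_n n (mat_col X i) z" for i
  define c where "c i = \<zeta> i - t * sgn (\<beta> i)" for i
  have Ip: "I \<subseteq> {..<p}" using I by (auto simp: supp_def)
  have fin: "finite I" using Ip finite_subset by blast
  have g: "symm g" unfolding g_def by (rule symm_gram)
  have t: "t > 0" "2 * r * \<sigma> = t" using \<sigma> r by (auto simp: t_def)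
  obtain v where v: "solves g I c v"
    using posdef_solvable[OF fin g] pd unfolding g_def by blast
  define s where "s = (\<lambda>i. if i < p then (if i \<in> I then \<beta> i + v i else 0) else undefined)"
  have resid: "(mat_vec p X \<beta> k + z k) - mat_vec p X s k = z k - (\<Sum>l\<in>I. X k l * v l)" for k
  proof -
    have 1: "mat_vec p X \<beta> k = (\<Sum>l\<in>I. X k l * \<beta> l)"
      unfolding mat_vec_def by (rule sum.mono_neutral_right) (use I in \<open>auto simp: supp_def\<close>)
    have "mat_vec p X s k = (\<Sum>l\<in>I. X k l * s l)"
      unfolding mat_vec_def by (rule sum.mono_neutral_right) (use Ip in \<open>auto simp: s_def\<close>)
    also have "\<dots> = (\<Sum>l\<in>I. X k l * \<beta> l + X k l * v l)"
      by (rule sum.cong) (use Ip in \<open>auto simp: s_def distrib_left\<close>)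
    finally show ?thesis using 1 by (simp add: sum.distrib)
  qed
  have corr: "inner_n n (mat_col X i) (\<lambda>k. (mat_vec p X \<beta> k + z k) - mat_vec p X s k)
      = \<zeta> i - (\<Sum>l\<in>I. g i l * v l)" for i
    unfolding resid g_def gram_row \<zeta>_def
    by (simp add: inner_n_def right_diff_distrib sum_subtractf)
  have comb: "(\<Sum>l\<in>I - {j}. c l * w j l) = \<zeta> j - inner_n n (proj_resid X I w j) z
      - t * (\<Sum>l\<in>I - {j}. w j l * sgn (\<beta> l))" for j
    unfolding inner_proj_resid
    by (simp add: c_def \<zeta>_def algebra_simps sum_subtractf sum_distrib_left)
  have tS: "\<bar>t * (\<Sum>l\<in>I - {j}. w j l * sgn (\<beta> l))\<bar> \<le> t * (1 / 8)" if "j < p" for j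
    using signs[OF that] t(1) by (simp add: abs_mult)
  have small: "\<bar>v i\<bar> < \<bar>\<beta> i\<bar>" if i: "i \<in> I" for i
  proof -
    define J where "J = I - {i}"
    have iJ: "I = insert i J" "i \<notin> J" "finite J" using i fin by (auto simp: J_def)
    have ip: "i < p" using i Ip by auto
    have row: "(\<Sum>l\<in>I. g k l * v l) = g k i * v i + (\<Sum>l\<in>J. g k l * v l)" for k
      using iJ by simp
    have vJ: "solves g J (\<lambda>l. c l - v i * g l i) v"
      unfolding solves_def
    proof
      fix k assume k: "k \<in> J"
      then have "(\<Sum>l\<in>I. g k l * v l) = c k" using v unfolding solves_def J_def by blast
      then show "(\<Sum>l\<in>J. g k l * v l) = c k - v i * g k i" unfolding row by (simp add: mult.commute)
    qed
    have wJ: "solves g J (\<lambda>l. g l i) (w i)" using w[OF ip] by (simp add: g_def J_def)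
    define \<epsilon> where "\<epsilon> = (\<Sum>l\<in>J. g l i * w i l)"
    have \<epsilon>: "\<epsilon> \<le> 1 / 8" using e[OF ip] by (simp add: \<epsilon>_def g_def J_def)
    have "(\<Sum>l\<in>J. g l i * v l) = (\<Sum>l\<in>J. (c l - v i * g l i) * w i l)"
      by (rule solves_symmetric[OF g wJ vJ])
    also have "\<dots> = (\<Sum>l\<in>J. c l * w i l) - v i * \<epsilon>"
      by (simp add: \<epsilon>_def algebra_simps sum_subtractf sum_distrib_left)
    finally have 1: "(\<Sum>l\<in>J. g l i * v l) = (\<Sum>l\<in>J. c l * w i l) - v i * \<epsilon>" .
    have "g i i * v i + (\<Sum>l\<in>J. g i l * v l) = c i"
      using v i unfolding solves_def row[symmetric] by blast
    moreover have "(\<Sum>l\<in>J. g i l * v l) = (\<Sum>l\<in>J. g l i * v l)" using g by (simp add: symm_def)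
    moreover have "g i i = 1" using X[OF ip] by (simp add: g_def gram_diag)
    ultimately have "v i * (1 - \<epsilon>) = c i - (\<Sum>l\<in>J. c l * w i l)"
      using 1 by (simp add: algebra_simps)
    also have "\<dots> = inner_n n (proj_resid X I w i) z - t * sgn (\<beta> i) + t * (\<Sum>l\<in>J. w i l * sgn (\<beta> l))"
      unfolding J_def comb by (simp add: c_def)
    finally have eq: "v i * (1 - \<epsilon>) = \<dots>" .
    have "\<bar>t * sgn (\<beta> i)\<bar> \<le> t" using t(1) by (simp add: abs_mult sgn_if)
    then have "\<bar>v i * (1 - \<epsilon>)\<bar> \<le> 8 / 5 * (\<sigma> * r) + t + t * (1 / 8)"
      unfolding eq using noise[OF ip] tS[OF ip] unfolding J_def by linarith
    also have "\<dots> < 7 * (\<sigma> * r)" using \<sigma> r by (simp add: t_def)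
    finally have "\<bar>v i\<bar> * (1 - \<epsilon>) < 7 * (\<sigma> * r)" using \<epsilon> by (simp add: abs_mult)
    moreover have "\<bar>v i\<bar> * (7 / 8) \<le> \<bar>v i\<bar> * (1 - \<epsilon>)" using \<epsilon> by (intro mult_left_mono) auto
    ultimately show ?thesis using ampl[OF i] by linarith
  qed
  have sgn_s: "sgn (s i) = sgn (\<beta> i)" if "i \<in> I" for i
    using small[OF that] that Ip by (auto simp: s_def sgn_if)
  have bs: "b j = s j" if "j < p" for j
  proof (rule lasso_estimate_unique[OF _ Ip pd _ _ _ _ b that])
    show "2 * r * \<sigma> > 0" using t by simp
    show "s \<in> Rvec p" by (auto simp: s_def Rvec_def PiE_def extensional_def)
    show "s j = 0" if "j < p" "j \<notin> I" for j using that by (simp add: s_def)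
    show "inner_n n (mat_col X i) (\<lambda>k. mat_vec p X \<beta> k + z k - mat_vec p X s k) = 2 * r * \<sigma> * sgn (s i)"
      if "i \<in> I" for i
      using v that unfolding corr t(2) sgn_s[OF that] solves_def by (auto simp: c_def)
    show "\<bar>inner_n n (mat_col X j) (\<lambda>k. mat_vec p X \<beta> k + z k - mat_vec p X s k)\<bar> < 2 * r * \<sigma>"
      if j: "j < p" "j \<notin> I" for j
    proof -
      have Ij: "I - {j} = I" using j by simp
      have "(\<Sum>l\<in>I. g j l * v l) = (\<Sum>l\<in>I. g l j * v l)" using g by (simp add: symm_def)
      also have "\<dots> = (\<Sum>l\<in>I. c l * w j l)"
        by (rule solves_symmetric[OF g _ v]) (use w[OF j(1)] in \<open>simp add: g_def Ij\<close>)
      finally have eq: "\<zeta> j - (\<Sum>l\<in>I. g j l * v l)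
          = inner_n n (proj_resid X I w j) z + t * (\<Sum>l\<in>I - {j}. w j l * sgn (\<beta> l))"
        using comb[of j] by (simp add: Ij)
      have "\<bar>\<zeta> j - (\<Sum>l\<in>I. g j l * v l)\<bar> \<le> 8 / 5 * (\<sigma> * r) + t * (1 / 8)"
        unfolding eq using noise[OF j(1)] tS[OF j(1)] by linarith
      also have "\<dots> < t" using \<sigma> r by (simp add: t_def)
      finally show ?thesis unfolding corr t(2) .
    qed
  qed
  have nz: "sgn (s i) \<noteq> 0" if "i \<in> I" for i
    using sgn_s[OF that] that I by (auto simp: supp_def sgn_if)
  have "supp p b = I"
  proof -
    have "b j \<noteq> 0 \<longleftrightarrow> j \<in> I" if "j < p" for j
      unfolding bs[OF that] using nz[of j] that by (cases "j \<in> I") (auto simp: s_def sgn_eq_0_iff)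
    then show ?thesis using Ip by (auto simp: supp_def)
  qed
  moreover have "sgn (b i) = sgn (\<beta> i)" if "i \<in> I" for i
    using bs[of i] sgn_s[OF that] Ip that by auto
  ultimately show ?thesis using I by simp
qed

section \<open>Tails of Gaussian and of sign sums\<close>

lemma normal_mgf:
  assumes "\<sigma> > 0"
  shows "(\<integral>\<^sup>+x. ennreal (exp (c * x)) \<partial>density lborel (\<lambda>x. ennreal (normal_density 0 \<sigma> x)))
     = ennreal (exp (c\<^sup>2 * \<sigma>\<^sup>2 / 2))"
proof -
  have shift: "normal_density 0 \<sigma> x * exp (c * x) = exp (c\<^sup>2 * \<sigma>\<^sup>2 / 2) * normal_density (c * \<sigma>\<^sup>2) \<sigma> x" for x
  proof -
    have "- x\<^sup>2 / (2 * \<sigma>\<^sup>2) + c * x = c\<^sup>2 * \<sigma>\<^sup>2 / 2 + - (x - c * \<sigma>\<^sup>2)\<^sup>2 / (2 * \<sigma>\<^sup>2)"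
      using assms by (simp add: field_simps power2_eq_square)
    then show ?thesis by (simp add: normal_density_def mult.left_commute flip: exp_add)
  qed
  have "(\<integral>\<^sup>+x. ennreal (exp (c * x)) \<partial>density lborel (\<lambda>x. ennreal (normal_density 0 \<sigma> x)))
      = (\<integral>\<^sup>+x. ennreal (normal_density 0 \<sigma> x) * ennreal (exp (c * x)) \<partial>lborel)"
    by (rule nn_integral_density) auto
  also have "\<dots> = (\<integral>\<^sup>+x. ennreal (exp (c\<^sup>2 * \<sigma>\<^sup>2 / 2)) * ennreal (normal_density (c * \<sigma>\<^sup>2) \<sigma> x) \<partial>lborel)"
    by (intro nn_integral_cong) (simp add: shift flip: ennreal_mult)
  also have "\<dots> = ennreal (exp (c\<^sup>2 * \<sigma>\<^sup>2 / 2)) * (\<integral>\<^sup>+x. ennreal (normal_density (c * \<sigma>\<^sup>2) \<sigma> x) \<partial>lborel)"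
    by (rule nn_integral_cmult) auto
  also have "(\<integral>\<^sup>+x. ennreal (normal_density (c * \<sigma>\<^sup>2) \<sigma> x) \<partial>lborel) = 1"
    using assms by (subst nn_integral_eq_integral) auto
  finally show ?thesis by simp
qed

lemma prob_space_gaussian_noise: "\<sigma> > 0 \<Longrightarrow> prob_space (gaussian_noise n \<sigma>)"
  unfolding gaussian_noise_def by (intro prob_space_PiM prob_space_normal_density)

lemma inner_measurable_gaussian_noise [measurable]:
  "(\<lambda>z. inner_n n u z) \<in> borel_measurable (gaussian_noise n \<sigma>)"
  unfolding gaussian_noise_def inner_n_def by measurable

text \<open>
  Chernoff's bound with the optimal exponent \<open>t / \<sigma>\<close>.
\<close>

lemma gaussian_noise_tail_one_sided:
  assumes \<sigma>: "\<sigma> > 0" and t: "t \<ge> 0" and u: "inner_n n u u \<le> 1"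
  shows "measure (gaussian_noise n \<sigma>) {z \<in> space (gaussian_noise n \<sigma>). inner_n n u z > \<sigma> * t}
     \<le> exp (- t\<^sup>2 / 2)"
proof -
  define N where "N = gaussian_noise n \<sigma>"
  define D where "D = density lborel (\<lambda>x. ennreal (normal_density 0 \<sigma> x))"
  define \<theta> where "\<theta> = t / \<sigma>"
  interpret prob_space N unfolding N_def by (rule prob_space_gaussian_noise[OF \<sigma>])
  interpret D: prob_space D unfolding D_def by (rule prob_space_normal_density[OF \<sigma>])
  interpret P: product_sigma_finite "\<lambda>i::nat. D"
    by standard
  have N: "N = Pi\<^sub>M {..<n} (\<lambda>_. D)" by (simp add: N_def gaussian_noise_def D_def)
  have [measurable]: "(\<lambda>z. inner_n n u z) \<in> borel_measurable N" by (simp add: N_def)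
  define A where "A = {z \<in> space N. inner_n n u z > \<sigma> * t}"
  have A: "A \<in> sets N" unfolding A_def by measurable
  have prod: "exp (\<theta> * inner_n n u z) = (\<Prod>k<n. exp (\<theta> * u k * z k))" for z
    by (simp add: inner_n_def sum_distrib_left exp_sum mult.assoc)
  have "emeasure N A = (\<integral>\<^sup>+z. indicator A z \<partial>N)" using A by simp
  also have "\<dots> \<le> (\<integral>\<^sup>+z. ennreal (exp (- t\<^sup>2)) * (\<Prod>k<n. ennreal (exp (\<theta> * u k * z k))) \<partial>N)"
  proof (rule nn_integral_mono)
    fix z
    have "indicator A z \<le> exp (\<theta> * (inner_n n u z - \<sigma> * t))"
      using \<sigma> t by (auto simp: indicator_def A_def \<theta>_def)
    also have "\<dots> = exp (- t\<^sup>2) * exp (\<theta> * inner_n n u z)"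
      using \<sigma> by (simp add: \<theta>_def right_diff_distrib power2_eq_square flip: exp_add)
    finally have "ennreal (indicator A z) \<le> ennreal (exp (- t\<^sup>2) * (\<Prod>k<n. exp (\<theta> * u k * z k)))"
      unfolding prod by (rule ennreal_leI)
    then show "indicator A z \<le> ennreal (exp (- t\<^sup>2)) * (\<Prod>k<n. ennreal (exp (\<theta> * u k * z k)))"
      by (simp add: ennreal_mult prod_nonneg prod_ennreal ennreal_indicator)
  qed
  also have "\<dots> = ennreal (exp (- t\<^sup>2)) * (\<integral>\<^sup>+z. (\<Prod>k<n. ennreal (exp (\<theta> * u k * z k))) \<partial>N)"
    by (rule nn_integral_cmult) (simp add: N D_def)
  also have "(\<integral>\<^sup>+z. (\<Prod>k<n. ennreal (exp (\<theta> * u k * z k))) \<partial>N)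
      = (\<Prod>k<n. \<integral>\<^sup>+x. ennreal (exp (\<theta> * u k * x)) \<partial>D)"
    unfolding N by (rule P.product_nn_integral_prod) (auto simp: D_def)
  also have "\<dots> = (\<Prod>k<n. ennreal (exp ((\<theta> * u k)\<^sup>2 * \<sigma>\<^sup>2 / 2)))"
    unfolding D_def by (simp add: normal_mgf[OF \<sigma>])
  also have "\<dots> = ennreal (exp (\<Sum>k<n. (\<theta> * u k)\<^sup>2 * \<sigma>\<^sup>2 / 2))"
    by (simp add: prod_ennreal exp_sum)
  also have "(\<Sum>k<n. (\<theta> * u k)\<^sup>2 * \<sigma>\<^sup>2 / 2) = t\<^sup>2 / 2 * inner_n n u u"
    using \<sigma> by (simp add: \<theta>_def inner_n_def sum_distrib_left power2_eq_square field_simps)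
  also have "ennreal (exp (- t\<^sup>2)) * ennreal (exp (t\<^sup>2 / 2 * inner_n n u u)) \<le> ennreal (exp (- t\<^sup>2 / 2))"
  proof -
    have "t\<^sup>2 / 2 * inner_n n u u \<le> t\<^sup>2 / 2 * 1" using u by (intro mult_left_mono) auto
    then show ?thesis by (simp add: ennreal_leI flip: ennreal_mult exp_add)
  qed
  finally have "emeasure N A \<le> ennreal (exp (- t\<^sup>2 / 2))" .
  then have "prob A \<le> exp (- t\<^sup>2 / 2)" by (simp add: emeasure_eq_measure)
  then show ?thesis by (simp add: A_def N_def)
qed

lemma gaussian_noise_tail:
  assumes \<sigma>: "\<sigma> > 0" and t: "t \<ge> 0" and u: "inner_n n u u \<le> 1"
  shows "measure (gaussian_noise n \<sigma>) {z \<in> space (gaussian_noise n \<sigma>). \<bar>inner_n n u z\<bar> > \<sigma> * t}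
     \<le> 2 * exp (- t\<^sup>2 / 2)"
proof -
  define N where "N = gaussian_noise n \<sigma>"
  interpret prob_space N unfolding N_def by (rule prob_space_gaussian_noise[OF \<sigma>])
  define A where "A u = {z \<in> space N. inner_n n u z > \<sigma> * t}" for u
  have [measurable]: "(\<lambda>z. inner_n n u z) \<in> borel_measurable N" for u by (simp add: N_def)
  have neg: "inner_n n (\<lambda>k. - u k) z = - inner_n n u z" for z by (simp add: inner_n_def sum_negf)
  have "inner_n n (\<lambda>k. - u k) (\<lambda>k. - u k) \<le> 1" using u by (simp add: inner_n_def)
  then have "prob (A u) + prob (A (\<lambda>k. - u k)) \<le> exp (- t\<^sup>2 / 2) + exp (- t\<^sup>2 / 2)"
    unfolding A_def N_def by (intro add_mono gaussian_noise_tail_one_sided \<sigma> t u)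
  moreover have "prob (A u \<union> A (\<lambda>k. - u k)) \<le> prob (A u) + prob (A (\<lambda>k. - u k))"
    by (rule measure_Un_le) (auto simp: A_def)
  moreover have "A u \<union> A (\<lambda>k. - u k) = {z \<in> space N. \<bar>inner_n n u z\<bar> > \<sigma> * t}"
    by (auto simp: A_def neg)
  ultimately show ?thesis by (simp add: N_def)
qed

lemma (in prob_space) rademacher_tail:
  assumes ind: "indep_vars (\<lambda>_. borel) X J" and fin: "finite J"
    and X: "\<And>i. i \<in> J \<Longrightarrow> prob {x \<in> space M. X i x = 1} = 1 / 2"
      "\<And>i. i \<in> J \<Longrightarrow> prob {x \<in> space M. X i x = - 1} = 1 / 2"
    and K: "K \<subseteq> J" and w: "(\<Sum>i\<in>K. (w i)\<^sup>2) \<le> \<delta>" and \<epsilon>: "\<epsilon> > 0" and \<delta>: "\<delta> > 0"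
  shows "prob {x \<in> space M. \<bar>\<Sum>i\<in>K. w i * X i x\<bar> > \<epsilon>} \<le> 2 * exp (- \<epsilon>\<^sup>2 / (2 * \<delta>))"
proof (cases "\<forall>i\<in>K. w i = 0")
  case True
  then show ?thesis using \<epsilon> by simp
next
  case False
  define Y where "Y i x = w i * X i x" for i x
  have finK: "finite K" using K fin finite_subset by blast
  have rv: "X i \<in> borel_measurable M" if "i \<in> J" for i
    using ind that unfolding indep_vars_def by auto
  have AE_X: "AE x in M. X i x = 1 \<or> X i x = - 1" if i: "i \<in> J" for i
  proof -
    note [measurable] = rv[OF i]
    have "prob {x \<in> space M. X i x = 1 \<or> X i x = - 1}
        = prob ({x \<in> space M. X i x = 1} \<union> {x \<in> space M. X i x = - 1})"
      by (rule arg_cong[where f = prob]) auto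
    also have "\<dots> = prob {x \<in> space M. X i x = 1} + prob {x \<in> space M. X i x = - 1}"
      by (rule finite_measure_Union) auto
    finally have "prob {x \<in> space M. X i x = 1 \<or> X i x = - 1} = 1" using X[OF i] by simp
    then show ?thesis by (subst (asm) prob_Collect_eq_1) auto
  qed
  have EX: "expectation (X i) = 0" if i: "i \<in> J" for i
  proof -
    note [measurable] = rv[OF i]
    have "expectation (X i) = expectation (\<lambda>x. indicator {x \<in> space M. X i x = 1} x - indicator {x \<in> space M. X i x = - 1} x :: real)"
      by (rule integral_cong_AE) (use AE_X[OF i] in \<open>auto elim!: eventually_mono simp: indicator_def\<close>)
    also have "\<dots> = prob {x \<in> space M. X i x = 1} - prob {x \<in> space M. X i x = - 1}"
      by (subst Bochner_Integration.integral_diff) (auto intro!: integrable_real_indicator simp: emeasure_eq_measure)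
    finally show ?thesis using X[OF i] by simp
  qed
  interpret H: Hoeffding_ineq M K Y "\<lambda>i. - \<bar>w i\<bar>" "\<lambda>i. \<bar>w i\<bar>" "\<Sum>i\<in>K. expectation (Y i)"
  proof unfold_locales
    show "finite K" by fact
    have "indep_vars (\<lambda>_. borel) X K" by (rule indep_vars_subset[OF ind K])
    then show "indep_vars (\<lambda>_. borel) Y K"
      unfolding Y_def by (rule indep_vars_compose2) auto
    show "AE x in M. Y i x \<in> {- \<bar>w i\<bar>..\<bar>w i\<bar>}" if "i \<in> K" for i
    proof -
      have "AE x in M. X i x = 1 \<or> X i x = - 1" using AE_X that K by blast
      then show ?thesis by (rule eventually_mono) (auto simp: Y_def)
    qed
  qed
  have mean: "(\<Sum>i\<in>K. expectation (Y i)) = 0"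
  proof (rule sum.neutral, rule ballI)
    fix i assume "i \<in> K"
    then show "expectation (Y i) = 0" using EX[of i] K unfolding Y_def by auto
  qed
  define V where "V = (\<Sum>i\<in>K. (w i)\<^sup>2)"
  have V: "(\<Sum>i\<in>K. (\<bar>w i\<bar> - - \<bar>w i\<bar>)\<^sup>2) = 4 * V"
    by (simp add: V_def sum_distrib_left power_mult_distrib)
  have Vpos: "V > 0"
  proof -
    obtain i where "i \<in> K" "w i \<noteq> 0" using False by blast
    then show ?thesis unfolding V_def by (intro sum_pos2[OF finK]) auto
  qed
  have rvK: "Y i \<in> borel_measurable M" if "i \<in> K" for i
    using rv[of i] that K unfolding Y_def by auto
  then have [measurable]: "(\<lambda>x. \<Sum>i\<in>K. Y i x) \<in> borel_measurable M" by measurable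
  have "prob {x \<in> space M. \<bar>\<Sum>i\<in>K. w i * X i x\<bar> > \<epsilon>} \<le> prob {x \<in> space M. \<bar>(\<Sum>i\<in>K. Y i x) - 0\<bar> \<ge> \<epsilon>}"
  proof (rule finite_measure_mono)
    show "{x \<in> space M. \<bar>(\<Sum>i\<in>K. Y i x) - 0\<bar> \<ge> \<epsilon>} \<in> sets M" by measurable
  qed (auto simp: Y_def)
  also have "\<dots> \<le> 2 * exp (- 2 * \<epsilon>\<^sup>2 / (4 * V))"
    using H.Hoeffding_ineq_abs_ge[of \<epsilon>] \<epsilon> Vpos unfolding mean V by simp
  also have "\<dots> \<le> 2 * exp (- \<epsilon>\<^sup>2 / (2 * \<delta>))"
  proof -
    have "\<epsilon>\<^sup>2 / (2 * \<delta>) \<le> \<epsilon>\<^sup>2 / (2 * V)" using w Vpos \<delta> by (intro divide_left_mono) (auto simp: V_def)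
    then show ?thesis by simp
  qed
  finally show ?thesis .
qed

section \<open>The generic sparse model\<close>

lemma measurable_coord:
  assumes "sets D = sets (\<Pi>\<^sub>M i\<in>{..<p}. (borel :: real measure))" "i < p"
  shows "(\<lambda>\<beta>. \<beta> i) \<in> borel_measurable D"
  using measurable_component_singleton[of i "{..<p}" "\<lambda>_. borel :: real measure"] assms(2)
  by (simp add: measurable_cong_sets[OF assms(1) refl])

lemma supp_event_measurable:
  assumes "sets D = sets (\<Pi>\<^sub>M i\<in>{..<p}. (borel :: real measure))"
  shows "{\<beta> \<in> space D. supp p \<beta> = J} \<in> sets D"
proof (cases "J \<subseteq> {..<p}")
  case True
  have [measurable]: "(\<lambda>\<beta>. \<beta> i) \<in> borel_measurable D" if "i \<in> {..<p}" for i
    using measurable_coord[OF assms] that by simp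
  have "{\<beta> \<in> space D. supp p \<beta> = J} = {\<beta> \<in> space D. \<forall>i\<in>{..<p}. (\<beta> i \<noteq> 0) = (i \<in> J)}"
    using True by (auto simp: supp_def)
  also have "\<dots> \<in> sets D" by measurable
  finally show ?thesis .
next
  case False
  then have "{\<beta> \<in> space D. supp p \<beta> = J} = {}" by (auto simp: supp_def)
  then show ?thesis by (metis sets.empty_sets)
qed

lemma supp_measurable:
  assumes D: "sets D = sets (\<Pi>\<^sub>M i\<in>{..<p}. (borel :: real measure))"
  shows "supp p \<in> D \<rightarrow>\<^sub>M count_space UNIV"
proof (rule measurableI)
  fix A :: "nat set set"
  have "supp p -` A \<inter> space D = (\<Union>J\<in>A \<inter> Pow {..<p}. {\<beta> \<in> space D. supp p \<beta> = J})"
    by (auto simp: supp_def)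
  also have "\<dots> \<in> sets D"
    by (intro sets.finite_UN finite_Int disjI2) (auto intro: supp_event_measurable[OF D])
  finally show "supp p -` A \<inter> space D \<in> sets D" .
qed auto

lemma generic_sparse_support_prob:
  assumes D: "generic_sparse p S D" and J: "J \<in> subsets_of_card p S"
  shows "measure D {\<beta> \<in> space D. supp p \<beta> = J} = 1 / real (p choose S)"
proof -
  have sets: "sets D = sets (\<Pi>\<^sub>M i\<in>{..<p}. (borel :: real measure))"
    and law: "distr D (count_space UNIV) (supp p) = measure_pmf (pmf_of_set (subsets_of_card p S))"
    using D by (auto simp: generic_sparse_def subsets_of_card_def)
  have "measure D {\<beta> \<in> space D. supp p \<beta> = J} = measure (distr D (count_space UNIV) (supp p)) {J}"
    by (subst measure_distr[OF supp_measurable[OF sets]]) (auto intro!: arg_cong[where f = "measure D"])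
  also have "\<dots> = pmf (pmf_of_set (subsets_of_card p S)) J"
    unfolding law by (simp add: pmf.rep_eq)
  also have "\<dots> = 1 / real (p choose S)"
    using J by (subst pmf_of_set) (auto simp: card_subsets_of_card)
  finally show ?thesis .
qed

text \<open>
  Hoeffding's inequality under the law conditioned on the support, united over all columns and
  multiplied by the probability of the support.
\<close>

lemma generic_sparse_signs_prob:
  assumes D: "generic_sparse p S D" and J: "J \<in> subsets_of_card p S"
    and \<epsilon>: "\<epsilon> > 0" and \<delta>: "\<delta> > 0"
    and w: "\<And>j. j < p \<Longrightarrow> (\<Sum>l\<in>J - {j}. (w j l)\<^sup>2) \<le> \<delta>"
  defines "A \<equiv> {\<beta> \<in> space D. supp p \<beta> = J \<and> (\<forall>j<p. \<bar>\<Sum>l\<in>J - {j}. w j l * sgn (\<beta> l)\<bar> \<le> \<epsilon>)}"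
  shows "A \<in> sets D"
    and "measure D A \<ge> (1 - 2 * real p * exp (- \<epsilon>\<^sup>2 / (2 * \<delta>))) / real (p choose S)"
proof -
  interpret prob_space D using D by (simp add: generic_sparse_def)
  have sets: "sets D = sets (\<Pi>\<^sub>M i\<in>{..<p}. (borel :: real measure))" and Sp: "S \<le> p"
    using D by (auto simp: generic_sparse_def)
  have Jp: "J \<subseteq> {..<p}" "card J = S" using J by (auto simp: subsets_of_card_def)
  have fin: "finite J" using Jp(1) finite_subset by blast
  define U where "U = {\<beta> \<in> space D. supp p \<beta> = J}"
  define Q where "Q = uniform_measure D U"
  define b where "b = (\<lambda>j. {\<beta> \<in> space D. \<bar>\<Sum>l\<in>J - {j}. w j l * sgn (\<beta> l)\<bar> > \<epsilon>})"
  have U: "U \<in> sets D" unfolding U_def by (rule supp_event_measurable[OF sets])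
  have PU: "measure D U = 1 / real (p choose S)"
    unfolding U_def by (rule generic_sparse_support_prob[OF D J])
  have choose: "real (p choose S) > 0" using Sp by (simp add: zero_less_binomial)
  have Unz: "emeasure D U \<noteq> 0" using PU choose by (simp add: emeasure_eq_measure)
  have "(\<lambda>\<beta>. sgn (\<beta> l)) \<in> borel_measurable D" if "l \<in> J" for l
    using measurable_coord[OF sets, of l] that Jp by auto
  then have [measurable]: "(\<lambda>\<beta>. \<Sum>l\<in>J - {j}. w j l * sgn (\<beta> l)) \<in> borel_measurable D" for j
    by (intro borel_measurable_sum borel_measurable_times) auto
  have b: "b j \<in> sets D" for j unfolding b_def by measurable
  have A_eq: "A = U - (\<Union>j\<in>{..<p}. b j)" by (auto simp: A_def U_def b_def not_less)
  show A: "A \<in> sets D" unfolding A_eq using U b by auto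
  interpret Q: prob_space Q
    unfolding Q_def by (rule prob_space_uniform_measure[OF Unz]) simp
  have spQ: "space Q = space D" by (simp add: Q_def)
  have ind: "Q.indep_vars (\<lambda>_. borel) (\<lambda>i \<beta>. sgn (\<beta> i)) J"
    and half: "\<And>i. i \<in> J \<Longrightarrow> \<P>(\<beta> in Q. sgn (\<beta> i) = 1) = 1 / 2"
      "\<And>i. i \<in> J \<Longrightarrow> \<P>(\<beta> in Q. sgn (\<beta> i) = - 1) = 1 / 2"
    using D Jp unfolding generic_sparse_def Let_def Q_def U_def by auto
  have tail: "measure Q (b j) \<le> 2 * exp (- \<epsilon>\<^sup>2 / (2 * \<delta>))" if "j < p" for j
    using Q.rademacher_tail[OF ind fin half _ w[OF that] \<epsilon> \<delta>] by (simp add: b_def spQ)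
  have "measure Q (\<Union>j\<in>{..<p}. b j) \<le> (\<Sum>j<p. measure Q (b j))"
    by (rule measure_UNION_le) (use b in \<open>auto simp: Q_def\<close>)
  also have "\<dots> \<le> (\<Sum>j<p. 2 * exp (- \<epsilon>\<^sup>2 / (2 * \<delta>)))"
    by (rule sum_mono) (use tail in auto)
  finally have "measure Q (\<Union>j\<in>{..<p}. b j) \<le> 2 * real p * exp (- \<epsilon>\<^sup>2 / (2 * \<delta>))" by simp
  moreover have "measure Q (\<Union>j\<in>{..<p}. b j) = measure D (U \<inter> (\<Union>j\<in>{..<p}. b j)) / measure D U"
    unfolding Q_def using Unz b U by (intro measure_uniform_measure) auto
  ultimately have "measure D (U \<inter> (\<Union>j\<in>{..<p}. b j)) \<le> 2 * real p * exp (- \<epsilon>\<^sup>2 / (2 * \<delta>)) * measure D U"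
    using choose by (simp add: PU field_simps)
  moreover have "measure D A = measure D U - measure D (U \<inter> (\<Union>j\<in>{..<p}. b j))"
    unfolding A_eq by (rule finite_measure_Diff') (use U b in auto)
  ultimately have "measure D A \<ge> (1 - 2 * real p * exp (- \<epsilon>\<^sup>2 / (2 * \<delta>))) * measure D U"
    by (simp add: left_diff_distrib)
  then show "measure D A \<ge> (1 - 2 * real p * exp (- \<epsilon>\<^sup>2 / (2 * \<delta>))) / real (p choose S)"
    by (simp add: PU)
qed

lemma gaussian_noise_all_small_prob:
  assumes \<sigma>: "\<sigma> > 0" and t: "t \<ge> 0" and u: "\<And>j. j < p \<Longrightarrow> inner_n n (u j) (u j) \<le> 1"
  defines "B \<equiv> {z \<in> space (gaussian_noise n \<sigma>). \<forall>j<p. \<bar>inner_n n (u j) z\<bar> \<le> \<sigma> * t}"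
  shows "B \<in> sets (gaussian_noise n \<sigma>)"
    and "measure (gaussian_noise n \<sigma>) B \<ge> 1 - 2 * real p * exp (- t\<^sup>2 / 2)"
proof -
  define N where "N = gaussian_noise n \<sigma>"
  interpret prob_space N unfolding N_def by (rule prob_space_gaussian_noise[OF \<sigma>])
  define b where "b = (\<lambda>j. {z \<in> space N. \<bar>inner_n n (u j) z\<bar> > \<sigma> * t})"
  have [measurable]: "(\<lambda>z. inner_n n v z) \<in> borel_measurable N" for v by (simp add: N_def)
  have b: "b j \<in> sets N" for j unfolding b_def by measurable
  have B_eq: "B = space N - (\<Union>j\<in>{..<p}. b j)" by (auto simp: B_def N_def b_def not_less)
  show "B \<in> sets (gaussian_noise n \<sigma>)" unfolding B_eq N_def[symmetric] using b by auto
  have "prob (\<Union>j\<in>{..<p}. b j) \<le> (\<Sum>j<p. prob (b j))"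
    by (rule measure_UNION_le) (use b in auto)
  also have "\<dots> \<le> (\<Sum>j<p. 2 * exp (- t\<^sup>2 / 2))"
    unfolding b_def N_def by (intro sum_mono gaussian_noise_tail \<sigma> t u) auto
  finally have "prob (\<Union>j\<in>{..<p}. b j) \<le> 2 * real p * exp (- t\<^sup>2 / 2)" by simp
  moreover have "prob B = 1 - prob (\<Union>j\<in>{..<p}. b j)"
    unfolding B_eq by (rule prob_compl) (use b in auto)
  ultimately show "measure (gaussian_noise n \<sigma>) B \<ge> 1 - 2 * real p * exp (- t\<^sup>2 / 2)"
    by (simp add: N_def)
qed

lemma measure_disjoint_rectangles:
  assumes M: "prob_space M" and N: "prob_space N" and fin: "finite K"
    and A: "\<And>k. k \<in> K \<Longrightarrow> A k \<in> sets M" and B: "\<And>k. k \<in> K \<Longrightarrow> B k \<in> sets N"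
    and disj: "disjoint_family_on A K"
  shows "measure (M \<Otimes>\<^sub>M N) (\<Union>k\<in>K. A k \<times> B k) = (\<Sum>k\<in>K. measure M (A k) * measure N (B k))"
proof -
  interpret M: prob_space M by fact
  interpret N: prob_space N by fact
  interpret P: pair_prob_space M N ..
  have "measure (M \<Otimes>\<^sub>M N) (\<Union>k\<in>K. A k \<times> B k) = (\<Sum>k\<in>K. measure (M \<Otimes>\<^sub>M N) (A k \<times> B k))"
    by (rule P.finite_measure_finite_Union[OF fin])
      (use A B disj in \<open>auto simp: disjoint_family_on_def Times_Int_Times\<close>)
  also have "\<dots> = (\<Sum>k\<in>K. measure M (A k) * measure N (B k))"
    using A B by (intro sum.cong refl) (simp add: measure_def N.emeasure_pair_measure_Times enn2real_mult)
  finally show ?thesis .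
qed

section \<open>Exact recovery by the lasso\<close>

theorem theorem1p3:
  "\<exists>A0 c0 C :: real. A0 > 0 \<and> c0 > 0 \<and> C > 0 \<and>
    (\<forall>(n::nat) (p::nat) (X :: nat \<Rightarrow> nat \<Rightarrow> real) (\<sigma>::real) (S::nat) (D :: (nat \<Rightarrow> real) measure).
       p \<ge> 2 \<longrightarrow>
       (\<forall>j<p. norm2 n (mat_col X j) = 1) \<longrightarrow>
       coherence n p X \<le> A0 / ln (real p) \<longrightarrow>
       \<sigma> > 0 \<longrightarrow>
       S \<ge> 1 \<longrightarrow>
       real S \<le> c0 * real p / ((op_norm n p X)\<^sup>2 * ln (real p)) \<longrightarrow>
       generic_sparse p S D \<longrightarrow>
       (AE \<beta> in D. (MIN i\<in>supp p \<beta>. \<bar>\<beta> i\<bar>) > 8 * \<sigma> * sqrt (2 * ln (real p))) \<longrightarrow>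
       with_prob_ge (D \<Otimes>\<^sub>M gaussian_noise n \<sigma>)
         (1 - 2 / real p * (1 / sqrt (2 * pi * ln (real p)) + real S / real p)
            - C * real p powr (- 2 * ln 2))
         (\<lambda>(\<beta>, z). \<forall>b. lasso_estimate n p X (\<lambda>i. mat_vec p X \<beta> i + z i)
                          (2 * sqrt (2 * ln (real p))) \<sigma> b \<longrightarrow>
              supp p b = supp p \<beta> \<and> (\<forall>i\<in>supp p \<beta>. sgn (b i) = sgn (\<beta> i))))"
proof -
  have "with_prob_ge (D \<Otimes>\<^sub>M gaussian_noise n \<sigma>)
         (1 - 2 / real p * (1 / sqrt (2 * pi * ln (real p)) + real S / real p)
            - 5 * real p powr (- 2 * ln 2))
         (\<lambda>(\<beta>, z). \<forall>b. lasso_estimate n p X (\<lambda>i. mat_vec p X \<beta> i + z i)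
                          (2 * sqrt (2 * ln (real p))) \<sigma> b \<longrightarrow>
              supp p b = supp p \<beta> \<and> (\<forall>i\<in>supp p \<beta>. sgn (b i) = sgn (\<beta> i)))"
    (is "with_prob_ge ?M ?q ?P")
    if p: "p \<ge> 2" and X: "\<forall>j<p. norm2 n (mat_col X j) = 1"
      and coh: "coherence n p X \<le> (1 / 320) / ln (real p)" and \<sigma>: "\<sigma> > 0" and S1: "S \<ge> 1"
      and S: "real S \<le> (1 / 320)\<^sup>2 * real p / ((op_norm n p X)\<^sup>2 * ln (real p))"
      and D: "generic_sparse p S D"
      and ampl: "AE \<beta> in D. (MIN i\<in>supp p \<beta>. \<bar>\<beta> i\<bar>) > 8 * \<sigma> * sqrt (2 * ln (real p))"
    for n p :: nat and X :: "nat \<Rightarrow> nat \<Rightarrow> real" and \<sigma> :: real and S :: nat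
      and D :: "(nat \<Rightarrow> real) measure"
  proof -
    define l where "l = ln (real p)"
    define r where "r = sqrt (2 * l)"
    define \<delta> where "\<delta> = 1 / (640 * l)"
    define N where "N = gaussian_noise n \<sigma>"
    have l: "l > 0" using p by (simp add: l_def)
    have r: "r > 0" "r\<^sup>2 = 2 * l" using l by (auto simp: r_def)
    have \<delta>: "\<delta> > 0" using l by (simp add: \<delta>_def)
    have powr_l: "exp (a * l) = real p powr a" for a using p by (simp add: l_def powr_def)
    interpret D: prob_space D using D by (simp add: generic_sparse_def)
    interpret N: prob_space N unfolding N_def by (rule prob_space_gaussian_noise[OF \<sigma>])
    have choose: "real (p choose S) > 0"
      using D by (simp add: generic_sparse_def zero_less_binomial)
    define G where "G = {J \<in> subsets_of_card p S. well_conditioned (gram n X) p \<delta> J}"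
    define w where "w = (\<lambda>J j. solution (gram n X) (J - {j}) (\<lambda>l. gram n X l j))"
    have w: "solves (gram n X) (J - {j}) (\<lambda>l. gram n X l j) (w J j)"
        "(\<Sum>l\<in>J - {j}. (w J j l)\<^sup>2) \<le> \<delta>" "(\<Sum>l\<in>J - {j}. gram n X l j * w J j l) \<le> 1 / 8"
      if J: "J \<in> G" "j < p" for J j
    proof -
      have fin: "finite J" and wc: "well_conditioned (gram n X) p \<delta> J"
        using J finite_subset by (auto simp: G_def subsets_of_card_def)
      have "posdef (gram n X) (J - {j})"
        by (rule posdef_subset[of _ J]) (use fin wc in \<open>auto simp: well_conditioned_def\<close>)
      then show "solves (gram n X) (J - {j}) (\<lambda>l. gram n X l j) (w J j)"
        unfolding w_def using fin by (intro solves_solution symm_gram) auto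
      show "(\<Sum>l\<in>J - {j}. (w J j l)\<^sup>2) \<le> \<delta>" "(\<Sum>l\<in>J - {j}. gram n X l j * w J j l) \<le> 1 / 8"
        using wc J(2) by (auto simp: w_def well_conditioned_def energy_def)
    qed
    obtain Z where Z: "Z \<in> null_sets D"
      and Zc: "{\<beta> \<in> space D. \<not> (MIN i\<in>supp p \<beta>. \<bar>\<beta> i\<bar>) > 8 * \<sigma> * sqrt (2 * ln (real p))} \<subseteq> Z"
      using ampl by (auto elim!: AE_E simp: null_sets_def)
    \<comment> \<open>For each admissible support a rectangle of good signs and good noise; the null set \<open>Z\<close> removes the
      vectors with too small an amplitude.  The noise level \<open>8/5\<close> has to be below \<open>2 - 2 / 8\<close> for sign recovery
      and large enough for the union of \<open>p\<close> tails: \<open>(8/5)\<^sup>2 - 1 > 2 log 2\<close>.\<close>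
    define A where "A = (\<lambda>J. {\<beta> \<in> space D. supp p \<beta> = J \<and>
        (\<forall>j<p. \<bar>\<Sum>l\<in>J - {j}. w J j l * sgn (\<beta> l)\<bar> \<le> 1 / 8)} - Z)"
    define B where "B = (\<lambda>J. {z \<in> space N.
        \<forall>j<p. \<bar>inner_n n (proj_resid X J (w J) j) z\<bar> \<le> \<sigma> * (8 / 5 * r)})"
    define E where "E = (\<Union>J\<in>G. A J \<times> B J)"
    define q\<^sub>1 where "q\<^sub>1 = 2 * real p * exp (- 5 * l)"
    define q\<^sub>2 where "q\<^sub>2 = 2 * real p * exp (- (64 / 25) * l)"
    define q\<^sub>0 where "q\<^sub>0 = real p powr (- 6)"
    have finG: "finite G" by (simp add: G_def)
    have A: "A J \<in> sets D" "measure D (A J) \<ge> (1 - q\<^sub>1) / real (p choose S)" if J: "J \<in> G" for J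
    proof -
      have J': "J \<in> subsets_of_card p S" using J by (simp add: G_def)
      note * = generic_sparse_signs_prob[OF D J', of "1 / 8" \<delta> "w J"]
      have rate: "- ((1 / 8)\<^sup>2 :: real) / (2 * \<delta>) = - 5 * l" using l by (simp add: \<delta>_def power2_eq_square)
      show "A J \<in> sets D" unfolding A_def using *(1) \<delta> w[OF J] Z by auto
      have "measure D (A J) = measure D {\<beta> \<in> space D. supp p \<beta> = J \<and>
        (\<forall>j<p. \<bar>\<Sum>l\<in>J - {j}. w J j l * sgn (\<beta> l)\<bar> \<le> 1 / 8)}"
        unfolding A_def by (rule measure_Diff_null_set[OF _ Z]) (use *(1) \<delta> w[OF J] in auto)
      then show "measure D (A J) \<ge> (1 - q\<^sub>1) / real (p choose S)"
        using *(2) \<delta> w[OF J] unfolding rate q\<^sub>1_def by auto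
    qed
    have B: "B J \<in> sets N" "measure N (B J) \<ge> 1 - q\<^sub>2" if J: "J \<in> G" for J
    proof -
      have u: "inner_n n (proj_resid X J (w J) j) (proj_resid X J (w J) j) \<le> 1" if "j < p" for j
        using X w[OF J that] that by (intro proj_resid_norm_le) auto
      have t: "8 / 5 * r \<ge> 0" using r by simp
      note * = gaussian_noise_all_small_prob[OF \<sigma> t u]
      have rate: "- (8 / 5 * r)\<^sup>2 / 2 = - (64 / 25) * l"
        unfolding power_mult_distrib r(2) by (simp add: power2_eq_square)
      show "B J \<in> sets N" unfolding B_def N_def by (rule *(1))
      show "measure N (B J) \<ge> 1 - q\<^sub>2" using *(2) unfolding B_def N_def q\<^sub>2_def rate by simp
    qed
    have P: "?P \<omega>" if \<omega>: "\<omega> \<in> E" for \<omega>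
    proof -
      obtain \<beta> z J where \<omega>_eq: "\<omega> = (\<beta>, z)" and J: "J \<in> G" and \<beta>: "\<beta> \<in> A J" and z: "z \<in> B J"
        using \<omega> by (auto simp: E_def)
      have supp: "supp p \<beta> = J" using \<beta> by (simp add: A_def)
      have fin: "finite J" using J finite_subset by (auto simp: G_def subsets_of_card_def)
      have "(MIN i\<in>supp p \<beta>. \<bar>\<beta> i\<bar>) > 8 * \<sigma> * sqrt (2 * ln (real p))"
        using \<beta> Zc by (auto simp: A_def)
      moreover have "(MIN i\<in>supp p \<beta>. \<bar>\<beta> i\<bar>) \<le> \<bar>\<beta> i\<bar>" if "i \<in> J" for i
        using fin that by (simp add: supp)
      ultimately have amp: "\<bar>\<beta> i\<bar> > 8 * (\<sigma> * r)" if "i \<in> J" for i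
        using that unfolding r_def l_def by (fastforce simp: mult.assoc)
      have "supp p b = supp p \<beta> \<and> (\<forall>i\<in>supp p \<beta>. sgn (b i) = sgn (\<beta> i))"
        if "lasso_estimate n p X (\<lambda>i. mat_vec p X \<beta> i + z i) (2 * r) \<sigma> b" for b
        by (rule lasso_sign_recovery[OF \<sigma> r(1) _ supp _ _ _ _ _ amp that, where w = "w J"])
          (use X J w \<beta> z in \<open>auto simp: G_def well_conditioned_def A_def B_def mult_ac\<close>)
      then show ?thesis by (simp add: \<omega>_eq r_def l_def)
    qed
    have disj: "disjoint_family_on A G" by (auto simp: disjoint_family_on_def A_def)
    have Esets: "E \<in> sets (D \<Otimes>\<^sub>M N)"
      unfolding E_def using finG A B by (intro sets.finite_UN pair_measureI) auto
    have ME: "measure (D \<Otimes>\<^sub>M N) E = (\<Sum>J\<in>G. measure D (A J) * measure N (B J))"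
      unfolding E_def
      by (rule measure_disjoint_rectangles[OF D.prob_space_axioms N.prob_space_axioms finG A(1) B(1) disj])
    have cardG: "real (card G) \<ge> (1 - q\<^sub>0) * real (p choose S)"
    proof -
      define H where "H = {J \<in> subsets_of_card p S. \<not> well_conditioned (gram n X) p \<delta> J}"
      have "card (G \<union> H) = card G + card H"
        by (rule card_Un_disjoint) (auto simp: G_def H_def)
      moreover have "G \<union> H = subsets_of_card p S" by (auto simp: G_def H_def)
      ultimately have "real (card G) + real (card H) = real (p choose S)"
        by (simp flip: card_subsets_of_card)
      moreover have "real (card H) \<le> q\<^sub>0 * real (p choose S)"
        unfolding H_def q\<^sub>0_def \<delta>_def l_def
        by (rule most_supports_well_conditioned[OF p _ coh S1 S]) (use X in auto)
      ultimately show ?thesis by (simp add: left_diff_distrib)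
    qed
    \<comment> \<open>The three failure probabilities are at most \<open>p\<^sup>-\<^sup>6\<close>, \<open>2 p\<^sup>-\<^sup>4\<close> and \<open>2 * p powr (- 39 / 25)\<close>; each exponent is below
      \<open>-3/2\<close>, and \<open>2 log 2 < 3/2\<close>.\<close>
    have q: "q\<^sub>0 + q\<^sub>1 + q\<^sub>2 \<le> 5 * real p powr (- 2 * ln 2)"
    proof -
      have mono: "exp (a * l) \<le> real p powr (- 2 * ln 2)" if "a \<le> - 3 / 2" for a
      proof -
        have "a \<le> - 2 * ln 2" using that ln2_le_25_over_36 by simp
        then show ?thesis unfolding powr_l using p by (intro powr_mono) auto
      qed
      have pe: "real p = exp (1 * l)" using p by (simp add: l_def)
      have "q\<^sub>1 = 2 * exp (- 4 * l)" "q\<^sub>2 = 2 * exp (- (39 / 25) * l)"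
        unfolding q\<^sub>1_def q\<^sub>2_def pe by (simp_all flip: exp_add)
      moreover have "q\<^sub>0 = exp (- 6 * l)" unfolding q\<^sub>0_def powr_l ..
      ultimately show ?thesis using mono[of "- 4"] mono[of "- (39 / 25)"] mono[of "- 6"] by simp
    qed
    have q_nonneg: "q\<^sub>0 \<ge> 0" "q\<^sub>1 \<ge> 0" "q\<^sub>2 \<ge> 0" by (simp_all add: q\<^sub>0_def q\<^sub>1_def q\<^sub>2_def)
    have main: "measure (D \<Otimes>\<^sub>M N) E \<ge> 1 - (q\<^sub>0 + q\<^sub>1 + q\<^sub>2)"
    proof (cases "q\<^sub>0 + q\<^sub>1 + q\<^sub>2 \<le> 1")
      case False
      have "0 \<le> measure (D \<Otimes>\<^sub>M N) E" by simp
      then show ?thesis using False by linarith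
    next
      case True
      have "(1 - q\<^sub>0) * ((1 - q\<^sub>1) * (1 - q\<^sub>2))
          = (1 - q\<^sub>0) * real (p choose S) * ((1 - q\<^sub>1) / real (p choose S) * (1 - q\<^sub>2))"
        using choose by simp
      also have "\<dots> \<le> real (card G) * ((1 - q\<^sub>1) / real (p choose S) * (1 - q\<^sub>2))"
        using cardG True q_nonneg by (intro mult_right_mono) auto
      also have "\<dots> = (\<Sum>J\<in>G. (1 - q\<^sub>1) / real (p choose S) * (1 - q\<^sub>2))" by simp
      also have "\<dots> \<le> (\<Sum>J\<in>G. measure D (A J) * measure N (B J))"
        using A(2) B(2) True q_nonneg by (intro sum_mono mult_mono) auto
      finally have "(1 - q\<^sub>0) * ((1 - q\<^sub>1) * (1 - q\<^sub>2)) \<le> measure (D \<Otimes>\<^sub>M N) E" unfolding ME .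
      moreover have "1 - (q\<^sub>0 + q\<^sub>1 + q\<^sub>2) \<le> (1 - q\<^sub>0) * ((1 - q\<^sub>1) * (1 - q\<^sub>2))"
      proof -
        have "1 - (q\<^sub>1 + q\<^sub>2) \<le> (1 - q\<^sub>1) * (1 - q\<^sub>2)" using q_nonneg by (simp add: algebra_simps)
        then have "(1 - q\<^sub>0) * (1 - (q\<^sub>1 + q\<^sub>2)) \<le> (1 - q\<^sub>0) * ((1 - q\<^sub>1) * (1 - q\<^sub>2))"
          using True q_nonneg by (intro mult_left_mono) auto
        moreover have "1 - (q\<^sub>0 + q\<^sub>1 + q\<^sub>2) \<le> (1 - q\<^sub>0) * (1 - (q\<^sub>1 + q\<^sub>2))"
          using mult_nonneg_nonneg[of "q\<^sub>0" "q\<^sub>1 + q\<^sub>2"] q_nonneg by (simp add: algebra_simps)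
        ultimately show ?thesis by linarith
      qed
      ultimately show ?thesis by linarith
    qed
    have "0 \<le> 2 / real p * (1 / sqrt (2 * pi * ln (real p)) + real S / real p)"
      using l by (simp add: l_def)
    then have "?q \<le> measure ?M E" using main q by (simp add: N_def)
    then show ?thesis
      unfolding with_prob_ge_def using Esets P by (intro bexI[of _ E]) (auto simp: N_def)
  qed
  then show ?thesis
    by (intro exI[of _ "1 / 320"] exI[of _ "(1 / 320)\<^sup>2"] exI[of _ 5]) simp
qed

end
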